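(* For each basic sequence $Q$ consider the seven sets $$N(Q),\quad RN(Q),\quad DN(Q),\quad N(Q)\cap RN(Q),\quad RN(Q)\cap DN(Q),\quad N(Q)\cap DN(Q),\quad N(Q)\cap RN(Q)\cap DN(Q),$$ and let $G$ be the directed graph whose vertices are these seven (formal) labels and whose directed edges are exactly: $RN\cap DN\to RN$; $RN\cap DN\to DN$; $N\to RN$; $N\cap DN\to RN\cap DN$; $N\cap DN\to N$; $N\cap RN\cap DN\to N\cap DN$; $N\cap DN\to N\cap RN\cap DN$; $N\to N\cap RN$; $N\cap RN\to N$. Then $G$ represents the complete containment relationship for basic sequences that are infinite in limit and fully divergent: for any two vertices $A$ and $B$ of $G$, the containment $A(Q)\subseteq B(Q)$ holds for every basic sequence $Q$ that is infinite in limit and fully divergent if and only if there is a directed path (possibly of length $0$) in $G$ from $A$ to $B$.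
   Context: A basic sequence is a sequence $Q=(q_n)_{n\ge1}$ of integers $q_n\ge 2$. The $Q$-Cantor series expansion of $x\in\mathbb{R}$ is the unique expansion $x=E_0+\sum_{n\ge1}\frac{E_n}{q_1\cdots q_n}$ with $E_0=\lfloor x\rfloor$, $E_n\in\{0,1,\ldots,q_n-1\}$ for $n\ge 1$, and $E_n\ne q_n-1$ for infinitely many $n$. $Q$ is infinite in limit if $q_n\to\infty$. Put $Q_n^{(k)}=\sum_{j=1}^n \frac1{q_jq_{j+1}\cdots q_{j+k-1}}$; $Q$ is $k$-divergent if $\lim_{n\to\infty}Q_n^{(k)}=\infty$ and fully divergent if it is $k$-divergent for all $k\ge1$. A block of length $k$ is an ordered $k$-tuple of non-negative integers. $N_n^Q(B,x)$ is the number of occurrences of the block $B$ starting at positions $\le n$ in the sequence of digits $E_1,E_2,\ldots$ of the $Q$-Cantor series expansion of $x$. $N(Q)$ ($Q$-normal numbers) is the set of real $x$ such that for every $k\ge1$ and every block $B$ of length $k$, $\lim_{n\to\infty}N_n^Q(B,x)/Q_n^{(k)}=1$. $RN(Q)$ ($Q$-ratio normal numbers) is the set of real $x$ such that for every $k\ge1$ and all blocks $B_1,B_2$ of length $k$, $\lim_{n\to\infty}N_n^Q(B_1,x)/N_n^Q(B_2,x)=1$. $DN(Q)$ ($Q$-distribution normal numbers) is the set of real $x$ such that the sequence $(q_1\cdots q_n x \bmod 1)_{n\ge0}$ is uniformly distributed mod $1$. *)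

theory Defs
  imports "HOL-Analysis.Analysis"
begin

text \<open>A sequence \<open>(q\<^sub>n)\<close>, \<open>n \<ge> 1\<close>, is a function on \<open>nat\<close> whose value at \<open>0\<close> is never used.\<close>

definition basic_sequence :: "(nat \<Rightarrow> nat) \<Rightarrow> bool" where
  "basic_sequence q \<longleftrightarrow> (\<forall>n\<ge>1. q n \<ge> 2)"

definition infinite_in_limit :: "(nat \<Rightarrow> nat) \<Rightarrow> bool" where
  "infinite_in_limit q \<longleftrightarrow> filterlim q at_top sequentially"

definition Q_sum :: "(nat \<Rightarrow> nat) \<Rightarrow> nat \<Rightarrow> nat \<Rightarrow> real" where
  "Q_sum q k n = (\<Sum>j=1..n. 1 / (\<Prod>i<k. real (q (j + i))))"

definition k_divergent :: "nat \<Rightarrow> (nat \<Rightarrow> nat) \<Rightarrow> bool" where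
  "k_divergent k q \<longleftrightarrow> filterlim (Q_sum q k) at_top sequentially"

definition fully_divergent :: "(nat \<Rightarrow> nat) \<Rightarrow> bool" where
  "fully_divergent q \<longleftrightarrow> (\<forall>k\<ge>1. k_divergent k q)"

definition is_cantor_expansion :: "(nat \<Rightarrow> nat) \<Rightarrow> real \<Rightarrow> (nat \<Rightarrow> int) \<Rightarrow> bool" where
  "is_cantor_expansion q x E \<longleftrightarrow>
     E 0 = \<lfloor>x\<rfloor> \<and>
     (\<forall>n\<ge>1. E n \<in> {0..int (q n) - 1}) \<and>
     infinite {n. n \<ge> 1 \<and> E n \<noteq> int (q n) - 1} \<and>
     (\<lambda>n. of_int (E (Suc n)) / (\<Prod>j=1..Suc n. real (q j))) sums (x - of_int (E 0))"

text \<open>For a basic sequence the expansion exists and is unique, so the description is proper.\<close>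

definition cantor_digit :: "(nat \<Rightarrow> nat) \<Rightarrow> real \<Rightarrow> nat \<Rightarrow> int" where
  "cantor_digit q x = (THE E. is_cantor_expansion q x E)"

text \<open>Blocks are lists of natural numbers. Only the digits \<open>E\<^sub>1, E\<^sub>2, \<dots>\<close> are searched, not the
  integer part \<open>E\<^sub>0\<close>; an occurrence need only start at a position \<open>\<le> n\<close>.\<close>

definition block_count :: "(nat \<Rightarrow> nat) \<Rightarrow> nat list \<Rightarrow> real \<Rightarrow> nat \<Rightarrow> nat" where
  "block_count q B x n =
     card {m \<in> {1..n}. \<forall>i<length B. cantor_digit q x (m + i) = int (B ! i)}"

definition normal_numbers :: "(nat \<Rightarrow> nat) \<Rightarrow> real set" where
  "normal_numbers q =
     {x. \<forall>k\<ge>1. \<forall>B. length B = k \<longrightarrow>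
           (\<lambda>n. real (block_count q B x n) / Q_sum q k n) \<longlonglongrightarrow> 1}"

text \<open>Since division by zero yields \<open>0\<close>, the limit below can be \<open>1\<close> only if the quotient is
  genuinely defined for all large \<open>n\<close>.\<close>

definition ratio_normal_numbers :: "(nat \<Rightarrow> nat) \<Rightarrow> real set" where
  "ratio_normal_numbers q =
     {x. \<forall>k\<ge>1. \<forall>B1 B2. length B1 = k \<and> length B2 = k \<longrightarrow>
           (\<lambda>n. real (block_count q B1 x n) / real (block_count q B2 x n)) \<longlonglongrightarrow> 1}"

definition uniformly_distributed_mod_1 :: "(nat \<Rightarrow> real) \<Rightarrow> bool" where
  "uniformly_distributed_mod_1 u \<longleftrightarrow>
     (\<forall>a b. 0 \<le> a \<and> a < b \<and> b \<le> 1 \<longrightarrow>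
        (\<lambda>N. real (card {n. n < N \<and> a \<le> frac (u n) \<and> frac (u n) < b}) / real N)
          \<longlonglongrightarrow> b - a)"

definition distribution_normal_numbers :: "(nat \<Rightarrow> nat) \<Rightarrow> real set" where
  "distribution_normal_numbers q =
     {x. uniformly_distributed_mod_1 (\<lambda>n. (\<Prod>j=1..n. real (q j)) * x)}"

datatype label = L_N | L_RN | L_DN | L_N_RN | L_RN_DN | L_N_DN | L_N_RN_DN

fun label_set :: "label \<Rightarrow> (nat \<Rightarrow> nat) \<Rightarrow> real set" where
  "label_set L_N q = normal_numbers q"
| "label_set L_RN q = ratio_normal_numbers q"
| "label_set L_DN q = distribution_normal_numbers q"
| "label_set L_N_RN q = normal_numbers q \<inter> ratio_normal_numbers q"
| "label_set L_RN_DN q = ratio_normal_numbers q \<inter> distribution_normal_numbers q"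
| "label_set L_N_DN q = normal_numbers q \<inter> distribution_normal_numbers q"
| "label_set L_N_RN_DN q =
     normal_numbers q \<inter> ratio_normal_numbers q \<inter> distribution_normal_numbers q"

definition G_edges :: "(label \<times> label) set" where
  "G_edges =
     {(L_RN_DN, L_RN), (L_RN_DN, L_DN), (L_N, L_RN),
      (L_N_DN, L_RN_DN), (L_N_DN, L_N),
      (L_N_RN_DN, L_N_DN), (L_N_DN, L_N_RN_DN),
      (L_N, L_N_RN), (L_N_RN, L_N)}"

end

theory Submission
  imports Defs
begin

text \<open>
  Everything rests on one pair \<open>(q, E)\<close> of a slowly growing basic sequence and a digit sequence that
  is both normal and distribution normal: \<open>E\<close> is a concatenation of chunks, where a chunk over the
  alphabet of size \<open>m\<close> lists all words of length \<open>m ^ m\<close>, \<open>q\<close> is constantly \<open>m\<close> there, and \<open>m\<close>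
  tends to infinity so slowly that no single chunk matters.

  Since \<open>q\<close> tends to infinity, normality only sees bounded digits, whereas distribution normality
  only sees the quotients \<open>E n / q n\<close> up to an error tending to \<open>0\<close>. Hence large digits may be
  changed without affecting block counts: replacing \<open>E n\<close> by its minimum with \<open>q n div 2\<close> destroys
  distribution normality but not normality. Forcing all digits to be nonzero destroys ratio
  normality but not distribution normality. Finally, with respect to \<open>2 * q\<close>, keep the digits below
  \<open>sqrt (q n)\<close> and double the others: the result is distribution normal and, as the block counts are
  those of \<open>E\<close>, ratio normal; but they exceed the normal count by a factor \<open>2 ^ k\<close>.
\<close>

section \<open>Limits of weighted averages\<close>

lemma quotient_limit:
  fixes c d G :: "nat \<Rightarrow> real"
  assumes G: "filterlim G at_top sequentially"
    and c: "(\<lambda>n. c n / G n) \<longlonglongrightarrow> L" and d: "(\<lambda>n. d n / G n) \<longlonglongrightarrow> 1"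
  shows "(\<lambda>n. c n / d n) \<longlonglongrightarrow> L"
proof -
  have "eventually (\<lambda>n. G n > 0) sequentially" using G by (simp add: filterlim_at_top_dense)
  then have "eventually (\<lambda>n. (c n / G n) / (d n / G n) = c n / d n) sequentially"
    by eventually_elim auto
  moreover have "(\<lambda>n. (c n / G n) / (d n / G n)) \<longlonglongrightarrow> L / 1"
    by (intro tendsto_divide c d) simp
  ultimately have "(\<lambda>n. c n / d n) \<longlonglongrightarrow> L / 1" by (rule Lim_transform_eventually[rotated])
  then show ?thesis by simp
qed

text \<open>Beyond some \<open>N\<close> each \<open>a c\<close> differs from \<open>L * w c\<close>
  by at most \<open>r/2 * w c\<close>. The earlier differences add up to a constant
  \<open>M\<close>, which the divergent sum of weights absorbs.\<close>

lemma stolz_cesaro: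
  fixes a w :: "nat \<Rightarrow> real"
  assumes w: "\<And>c. w c > 0"
    and W: "filterlim (\<lambda>n. \<Sum>c<n. w c) at_top sequentially"
    and lim: "(\<lambda>c. a c / w c) \<longlonglongrightarrow> L"
  shows "(\<lambda>n. (\<Sum>c<n. a c) / (\<Sum>c<n. w c)) \<longlonglongrightarrow> L"
proof (rule LIMSEQ_I)
  fix r :: real assume r: "r > 0"
  obtain N where N: "\<And>c. c \<ge> N \<Longrightarrow> \<bar>a c / w c - L\<bar> < r/2"
    using LIMSEQ_D[OF lim, of "r/2"] r by auto
  define M where "M = (\<Sum>c<N. \<bar>a c - L * w c\<bar>)"
  have bound: "\<bar>\<Sum>c<n. a c - L * w c\<bar> \<le> M + r/2 * (\<Sum>c<n. w c)" for n
  proof -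
    have "\<bar>\<Sum>c<n. a c - L * w c\<bar> \<le> (\<Sum>c<n. \<bar>a c - L * w c\<bar>)" by (rule sum_abs)
    also have "\<dots> \<le> (\<Sum>c<n. (if c < N then \<bar>a c - L * w c\<bar> else 0) + r/2 * w c)"
    proof (rule sum_mono)
      fix c show "\<bar>a c - L * w c\<bar> \<le> (if c < N then \<bar>a c - L * w c\<bar> else 0) + r/2 * w c"
      proof (cases "c < N")
        case False
        then have "\<bar>a c / w c - L\<bar> * w c \<le> r/2 * w c" using N[of c] w[of c] by (intro mult_right_mono) auto
        moreover have "\<bar>a c / w c - L\<bar> * w c = \<bar>(a c / w c - L) * w c\<bar>" using w[of c] by (simp add: abs_mult)
        moreover have "(a c / w c - L) * w c = a c - L * w c" using w[of c] by (simp add: field_simps)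
        ultimately show ?thesis using False by simp
      qed (use r w[of c] in simp)
    qed
    also have "\<dots> = (\<Sum>c<n. (if c < N then \<bar>a c - L * w c\<bar> else 0)) + r/2 * (\<Sum>c<n. w c)"
      by (simp add: sum.distrib sum_distrib_left)
    also have "(\<Sum>c<n. (if c < N then \<bar>a c - L * w c\<bar> else 0)) = (\<Sum>c\<in>{..<n}\<inter>{..<N}. \<bar>a c - L * w c\<bar>)"
      by (simp add: sum.inter_restrict)
    also have "\<dots> \<le> M" unfolding M_def by (rule sum_mono2) auto
    finally show ?thesis by simp
  qed
  have "eventually (\<lambda>n. (\<Sum>c<n. w c) > 2 * M / r + 1) sequentially"
    using W by (simp add: filterlim_at_top_dense)
  then obtain n0 where n0: "\<And>n. n \<ge> n0 \<Longrightarrow> (\<Sum>c<n. w c) > 2 * M / r + 1"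
    by (auto simp: eventually_sequentially)
  have M0: "M \<ge> 0" by (auto simp: M_def intro: sum_nonneg)
  have "norm ((\<Sum>c<n. a c) / (\<Sum>c<n. w c) - L) < r" if "n \<ge> n0" for n
  proof -
    let ?W = "\<Sum>c<n. w c"
    have W0: "?W > 2 * M / r + 1" by (rule n0[OF that])
    have Wp: "?W > 0" using W0 M0 r by (smt (verit) divide_nonneg_pos)
    have "2 * M / r < ?W" using W0 by simp
    then have "2 * M < r * ?W" using r by (simp add: field_simps)
    then have *: "M + r/2 * ?W < r * ?W" by simp
    have "(\<Sum>c<n. a c) / ?W - L = (\<Sum>c<n. a c - L * w c) / ?W"
      using Wp by (simp add: sum_subtractf sum_distrib_left[symmetric] field_simps)
    also have "\<bar>\<dots>\<bar> \<le> (M + r/2 * ?W) / ?W"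
      using bound[of n] Wp by (simp add: abs_divide divide_right_mono)
    also have "\<dots> < r" using * Wp by (simp add: pos_divide_less_eq)
    finally show ?thesis by simp
  qed
  then show "\<exists>no. \<forall>n\<ge>no. norm ((\<Sum>c<n. a c) / (\<Sum>c<n. w c) - L) < r" by blast
qed

text \<open>\<open>s c\<close> is the largest \<open>m\<close> up to \<open>c + 2\<close> with
  \<open>g m \<le> c + g 2\<close>. The value 2 always qualifies, and any fixed \<open>m\<close>
  qualifies for all large \<open>c\<close>, so the maxima tend to infinity. The cap
  \<open>c + 2\<close> keeps the set finite for every \<open>g\<close>.\<close>

lemma slow_sequence:
  fixes g :: "nat \<Rightarrow> nat"
  obtains s where "\<And>c. 2 \<le> s c" "\<And>c. g (s c) \<le> c + g 2" "filterlim s at_top sequentially"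
proof -
  define S where "S c = {m. 2 \<le> m \<and> m \<le> c + 2 \<and> g m \<le> c + g 2}" for c
  have fin: "finite (S c)" for c by (rule finite_subset[of _ "{..c+2}"]) (auto simp: S_def)
  have ne: "S c \<noteq> {}" for c by (auto simp: S_def intro!: exI[of _ 2])
  have in_S: "Max (S c) \<in> S c" for c by (rule Max_in[OF fin ne])
  have "filterlim (\<lambda>c. Max (S c)) at_top sequentially"
    unfolding filterlim_at_top eventually_sequentially
  proof
    fix M
    have "M \<le> Max (S c)" if "c \<ge> max M (g (M + 2))" for c
    proof -
      have "M + 2 \<in> S c" using that by (auto simp: S_def)
      from Max_ge[OF fin this] show ?thesis by simp
    qed
    then show "\<exists>N. \<forall>n\<ge>N. M \<le> Max (S n)" by blast
  qed
  then show ?thesis using in_S by (intro that[of "\<lambda>c. Max (S c)"]) (auto simp: S_def)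
qed

section \<open>Cutting the positions 0, 1, 2, ... into consecutive chunks\<close>

locale chunks =
  fixes len :: "nat \<Rightarrow> nat"
  assumes len_pos: "len c > 0"
begin

definition start :: "nat \<Rightarrow> nat" where "start c = (\<Sum>i<c. len i)"

definition chunk :: "nat \<Rightarrow> nat" where "chunk p = (LEAST c. p < start (Suc c))"

lemma start_Suc: "start (Suc c) = start c + len c"
  by (simp add: start_def)

lemma start_mono: "c \<le> d \<Longrightarrow> start c \<le> start d"
  unfolding start_def by (rule sum_mono2) auto

lemma start_ge: "c \<le> start c"
proof (induction c)
  case (Suc c) then show ?case using len_pos[of c] by (simp add: start_Suc)
qed simp

lemma less_start_chunk: "p < start (Suc (chunk p))"
  unfolding chunk_def by (rule LeastI[of _ p]) (use start_ge[of "Suc p"] in simp)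

lemma start_chunk_le: "start (chunk p) \<le> p"
proof (cases "chunk p")
  case 0 then show ?thesis by (simp add: start_def)
next
  case (Suc c)
  then have "\<not> p < start (Suc c)" using not_less_Least[of c "\<lambda>c. p < start (Suc c)"]
    by (simp add: chunk_def)
  then show ?thesis using Suc by simp
qed

lemma chunk_eq:
  assumes "i < len c" shows "chunk (start c + i) = c"
proof (rule antisym)
  show "chunk (start c + i) \<le> c"
    unfolding chunk_def by (rule Least_le) (use assms in \<open>simp add: start_Suc\<close>)
  show "c \<le> chunk (start c + i)"
  proof (rule ccontr)
    assume "\<not> ?thesis"
    then have "start (Suc (chunk (start c + i))) \<le> start c" by (intro start_mono) simp
    with less_start_chunk[of "start c + i"] show False by simp
  qed
qed

lemma filterlim_chunk: "filterlim chunk at_top sequentially"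
  unfolding filterlim_at_top eventually_sequentially
proof (intro allI exI impI)
  fix M p assume p: "start M \<le> p"
  show "M \<le> chunk p"
  proof (rule ccontr)
    assume "\<not> ?thesis"
    then have "start (Suc (chunk p)) \<le> start M" by (intro start_mono) simp
    with less_start_chunk[of p] p show False by simp
  qed
qed

lemma sum_start: "(\<Sum>p<start c. f p) = (\<Sum>d<c. \<Sum>i<len d. f (start d + i))"
  for f :: "nat \<Rightarrow> real"
proof (induction c)
  case (Suc c)
  have "(\<Sum>p<start (Suc c). f p) = (\<Sum>p<start c. f p) + (\<Sum>p=start c..<start (Suc c). f p)"
    by (simp add: sum.atLeastLessThan_concat lessThan_atLeast0 start_mono)
  also have "(\<Sum>p=start c..<start (Suc c). f p) = (\<Sum>i<len c. f (start c + i))"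
    using sum.shift_bounds_nat_ivl[of f 0 "start c" "len c"]
    by (simp add: start_Suc lessThan_atLeast0 add.commute)
  finally show ?case using Suc by simp
qed (simp add: start_def)

text \<open>At chunk borders this is \<open>stolz_cesaro\<close>. Inside a chunk the sum lies
  between its values at the two ends, and by \<open>small\<close> the weight of one more chunk does
  not change the limit of the ratio.\<close>

lemma partial_sums_ratio:
  fixes f w :: "nat \<Rightarrow> real"
  assumes f: "\<And>p. f p \<ge> 0" and w: "\<And>c. w c > 0"
    and W: "filterlim (\<lambda>n. \<Sum>c<n. w c) at_top sequentially"
    and small: "(\<lambda>n. w n / (\<Sum>c<n. w c)) \<longlonglongrightarrow> 0"
    and lim: "(\<lambda>c. (\<Sum>i<len c. f (start c + i)) / w c) \<longlonglongrightarrow> L"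
  shows "(\<lambda>n. (\<Sum>p<n. f p) / (\<Sum>c<chunk n. w c)) \<longlonglongrightarrow> L"
proof -
  define F where "F c = (\<Sum>p<start c. f p)" for c
  define W' where "W' c = (\<Sum>i<c. w i)" for c
  have pos: "eventually (\<lambda>c. W' c > 0) sequentially"
    using W by (simp add: filterlim_at_top_dense W'_def)
  have lower: "(\<lambda>c. F c / W' c) \<longlonglongrightarrow> L"
    unfolding F_def W'_def sum_start by (rule stolz_cesaro[OF w W lim])
  \<comment> \<open>The factor \<open>1 + w c / W' c\<close> equals
    \<open>W' (Suc c) / W' c\<close>, so it exchanges the denominator for that of the previous
    border.\<close>
  have "(\<lambda>c. F (Suc c) / W' (Suc c) * (1 + w c / W' c)) \<longlonglongrightarrow> L * (1 + 0)"
    using small lower by (intro tendsto_intros LIMSEQ_Suc[of "\<lambda>c. F c / W' c"]) (auto simp: W'_def)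
  moreover have "eventually (\<lambda>c. F (Suc c) / W' (Suc c) * (1 + w c / W' c) = F (Suc c) / W' c) sequentially"
    using pos
  proof eventually_elim
    case (elim c)
    have "1 + w c / W' c = W' (Suc c) / W' c" using elim by (simp add: W'_def field_simps)
    moreover have "W' (Suc c) \<noteq> 0" using elim w[of c] by (simp add: W'_def)
    ultimately show ?case by simp
  qed
  ultimately have upper: "(\<lambda>c. F (Suc c) / W' c) \<longlonglongrightarrow> L"
    by (simp add: tendsto_cong)
  have pos': "eventually (\<lambda>n. W' (chunk n) > 0) sequentially"
    by (rule eventually_compose_filterlim[OF pos filterlim_chunk])
  show ?thesis
  proof (rule tendsto_sandwich)
    show "(\<lambda>n. F (chunk n) / W' (chunk n)) \<longlonglongrightarrow> L"
      by (rule filterlim_compose[OF lower filterlim_chunk])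
    show "(\<lambda>n. F (Suc (chunk n)) / W' (chunk n)) \<longlonglongrightarrow> L"
      by (rule filterlim_compose[OF upper filterlim_chunk])
    show "eventually (\<lambda>n. F (chunk n) / W' (chunk n) \<le> (\<Sum>p<n. f p) / (\<Sum>c<chunk n. w c)) sequentially"
      using pos'
    proof eventually_elim
      case (elim n)
      have "F (chunk n) \<le> (\<Sum>p<n. f p)" unfolding F_def
        using start_chunk_le[of n] f by (intro sum_mono2) auto
      then show ?case using elim by (simp add: W'_def divide_right_mono)
    qed
    show "eventually (\<lambda>n. (\<Sum>p<n. f p) / (\<Sum>c<chunk n. w c) \<le> F (Suc (chunk n)) / W' (chunk n)) sequentially"
      using pos'
    proof eventually_elim
      case (elim n)
      have "(\<Sum>p<n. f p) \<le> F (Suc (chunk n))" unfolding F_def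
        using less_start_chunk[of n] f by (intro sum_mono2) auto
      then show ?case using elim by (simp add: W'_def divide_right_mono)
    qed
  qed
qed

end

section \<open>Cantor series expansions\<close>

definition qprod :: "(nat \<Rightarrow> nat) \<Rightarrow> nat \<Rightarrow> real" where
  "qprod q n = (\<Prod>j=1..n. real (q j))"

lemma qprod_0 [simp]: "qprod q 0 = 1"
  by (simp add: qprod_def)

lemma qprod_Suc: "qprod q (Suc n) = qprod q n * real (q (Suc n))"
  by (simp add: qprod_def)

lemma basic_sequence_pos:
  assumes "basic_sequence q" shows "real (q (Suc n)) > 0"
proof -
  have "2 \<le> q (Suc n)" using assms by (simp add: basic_sequence_def)
  then show ?thesis by simp
qed

lemma qprod_ge:
  assumes "basic_sequence q" shows "qprod q n \<ge> 2 ^ n"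
proof (induction n)
  case (Suc n)
  have "2 \<le> real (q (Suc n))" using assms by (simp add: basic_sequence_def)
  with Suc have "2 ^ n * 2 \<le> qprod q n * real (q (Suc n))"
    by (intro mult_mono) (auto simp: qprod_def intro: prod_nonneg)
  then show ?case by (simp add: qprod_Suc mult.commute)
qed simp

lemma qprod_pos: "basic_sequence q \<Longrightarrow> qprod q n > 0"
  using qprod_ge[of q n] by (smt (verit) zero_less_power)

text \<open>A maximal digit contributes the difference of two consecutive values of
  \<open>1 / qprod q\<close>, so the series telescopes. It bounds every tail of an expansion from
  above.\<close>

lemma max_digits_sums:
  assumes q: "basic_sequence q"
  shows "(\<lambda>j. (real (q (Suc (j + n))) - 1) / qprod q (Suc (j + n))) sums (1 / qprod q n)"
proof -
  have lim: "(\<lambda>j. 1 / qprod q (j + n)) \<longlonglongrightarrow> 0"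
  proof (rule tendsto_sandwich[where f = "\<lambda>_. 0" and h = "\<lambda>j. (1/2) ^ (j + n)"])
    show "(\<lambda>j. (1/2) ^ (j + n) :: real) \<longlonglongrightarrow> 0"
      by (rule LIMSEQ_ignore_initial_segment) (simp add: LIMSEQ_power_zero)
    show "eventually (\<lambda>j. 1 / qprod q (j + n) \<le> (1/2) ^ (j + n)) sequentially"
      using qprod_ge[OF q] by (intro always_eventually allI) (simp add: power_one_over frac_le)
    show "eventually (\<lambda>j. 0 \<le> 1 / qprod q (j + n)) sequentially"
      using qprod_pos[OF q] by (intro always_eventually allI) (simp add: less_imp_le)
  qed simp
  have "(\<lambda>j. 1 / qprod q (j + n) - 1 / qprod q (Suc j + n)) sums (1 / qprod q (0 + n) - 0)"
    by (rule telescope_sums'[OF lim])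
  moreover have "1 / qprod q (j + n) - 1 / qprod q (Suc j + n)
      = (real (q (Suc (j + n))) - 1) / qprod q (Suc (j + n))" for j
  proof -
    have "qprod q (j + n) > 0" "real (q (Suc (j + n))) > 0"
      by (rule qprod_pos[OF q], rule basic_sequence_pos[OF q])
    then show ?thesis by (simp add: qprod_Suc field_simps)
  qed
  ultimately show ?thesis by simp
qed

section \<open>Tails of an expansion and recovery of the digits\<close>

definition tail_sum :: "(nat \<Rightarrow> nat) \<Rightarrow> (nat \<Rightarrow> int) \<Rightarrow> nat \<Rightarrow> real" where
  "tail_sum q E n = (\<Sum>j. of_int (E (Suc (j + n))) / qprod q (Suc (j + n)))"

text \<open>The conditions of a Cantor expansion that concern the digits alone, without the number
  they represent; \<open>E 0\<close> is left arbitrary.\<close>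

locale digit_sequence =
  fixes q :: "nat \<Rightarrow> nat" and E :: "nat \<Rightarrow> int"
  assumes q: "basic_sequence q"
    and range: "\<And>n. n \<ge> 1 \<Longrightarrow> E n \<in> {0..int (q n) - 1}"
    and inf: "infinite {n. n \<ge> 1 \<and> E n \<noteq> int (q n) - 1}"
begin

lemma digit_bounds: "0 \<le> E (Suc n)" "real_of_int (E (Suc n)) \<le> real (q (Suc n)) - 1"
  using range[of "Suc n"] by auto

lemma summable_tail: "summable (\<lambda>j. of_int (E (Suc (j + n))) / qprod q (Suc (j + n)))"
proof -
  have "norm (of_int (E (Suc (j + n))) / qprod q (Suc (j + n)))
      \<le> (real (q (Suc (j + n))) - 1) / qprod q (Suc (j + n))" for j
    using digit_bounds[of "j + n"] qprod_pos[OF q, of "Suc (j + n)"]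
    by (simp add: abs_divide divide_right_mono)
  then show ?thesis
    by (intro summable_comparison_test'[OF sums_summable[OF max_digits_sums[OF q]], of 0])
qed

lemma tail_sum_nonneg: "0 \<le> tail_sum q E n"
  unfolding tail_sum_def
proof (rule suminf_nonneg[OF summable_tail])
  fix j show "0 \<le> of_int (E (Suc (j + n))) / qprod q (Suc (j + n))"
    using digit_bounds[of "j + n"] qprod_pos[OF q, of "Suc (j + n)"]
    by simp
qed

text \<open>Termwise comparison with \<open>max_digits_sums\<close>; \<open>inf\<close> supplies a
  digit beyond \<open>n\<close> that is not maximal and makes the inequality strict.\<close>

lemma tail_sum_less: "tail_sum q E n < 1 / qprod q n"
proof -
  let ?u = "\<lambda>j. of_int (E (Suc (j + n))) / qprod q (Suc (j + n))"
  let ?v = "\<lambda>j. (real (q (Suc (j + n))) - 1) / qprod q (Suc (j + n))"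
  have sv: "summable ?v" "suminf ?v = 1 / qprod q n"
    using max_digits_sums[OF q, of n] by (auto simp: sums_iff)
  obtain l where l: "l > n" "E l \<noteq> int (q l) - 1"
    using inf unfolding infinite_nat_iff_unbounded by blast
  define i where "i = l - Suc n"
  have li: "l = Suc (i + n)" using l by (simp add: i_def)
  have nn: "0 \<le> ?v j - ?u j" for j
    using digit_bounds[of "j + n"] qprod_pos[OF q, of "Suc (j + n)"]
    by (simp add: divide_right_mono)
  have "E (Suc (i + n)) < int (q (Suc (i + n))) - 1"
    using l li range[of l] by auto
  then have "0 < ?v i - ?u i"
    using qprod_pos[OF q, of "Suc (i + n)"]
    by (simp add: divide_strict_right_mono)
  then have "0 < (\<Sum>j. ?v j - ?u j)"
    by (rule suminf_pos2[OF summable_diff[OF sv(1) summable_tail] nn])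
  then show ?thesis
    unfolding tail_sum_def using suminf_diff[OF sv(1) summable_tail[of n]] sv(2) by simp
qed

lemma tail_sum_Suc: "tail_sum q E n = of_int (E (Suc n)) / qprod q (Suc n) + tail_sum q E (Suc n)"
  unfolding tail_sum_def using suminf_split_head[OF summable_tail[of n]] by simp

lemma scaled_tail_sum_in_unit: "qprod q n * tail_sum q E n \<in> {0..<1}"
  using tail_sum_nonneg[of n] tail_sum_less[of n] qprod_pos[OF q, of n]
  by (auto simp: field_simps)

text \<open>The scaled contribution of the first \<open>n\<close> digits obeys a Horner recursion
  with integer coefficients.\<close>

lemma qprod_value_minus_tail: "qprod q n * (tail_sum q E 0 - tail_sum q E n) \<in> \<int>"
proof (induction n)
  case (Suc n)
  have "qprod q (Suc n) * (tail_sum q E 0 - tail_sum q E (Suc n))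
      = real (q (Suc n)) * (qprod q n * (tail_sum q E 0 - tail_sum q E n)) + of_int (E (Suc n))"
    using qprod_pos[OF q, of n] basic_sequence_pos[OF q, of n] unfolding tail_sum_Suc[of n]
    by (simp add: qprod_Suc field_simps)
  also have "\<dots> \<in> \<int>"
    by (intro Ints_add Ints_mult Suc.IH Ints_of_int Ints_of_nat)
  finally show ?case .
qed simp

text \<open>Scaling by \<open>qprod q n\<close> turns everything before the tail into an integer and
  puts the tail into [0,1). Thus the orbit that defines distribution normality consists of scaled
  tails.\<close>

lemma frac_qprod_value: "frac (qprod q n * (tail_sum q E 0 + of_int z)) = qprod q n * tail_sum q E n"
proof -
  have "qprod q n * (tail_sum q E 0 + of_int z) - qprod q n * tail_sum q E n
      = qprod q n * (tail_sum q E 0 - tail_sum q E n) + qprod q n * of_int z"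
    by (simp add: algebra_simps)
  also have "\<dots> \<in> \<int>"
    unfolding qprod_def[of q n, symmetric]
    by (intro Ints_add qprod_value_minus_tail Ints_mult) (auto simp: qprod_def intro: Ints_prod)
  finally show ?thesis using scaled_tail_sum_in_unit[of n] by (simp add: frac_unique_iff)
qed

lemma scaled_frac_eq: "real (q (Suc n)) * (qprod q n * tail_sum q E n)
    = of_int (E (Suc n)) + qprod q (Suc n) * tail_sum q E (Suc n)"
  using qprod_pos[OF q, of n] basic_sequence_pos[OF q, of n] unfolding tail_sum_Suc[of n]
  by (simp add: qprod_Suc field_simps)

lemma digit_eq_floor: "E (Suc n) = \<lfloor>real (q (Suc n)) * (qprod q n * tail_sum q E n)\<rfloor>"
  using scaled_tail_sum_in_unit[of "Suc n"] unfolding scaled_frac_eq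
  by (simp add: floor_eq_iff)

end

lemma is_cantor_expansion_iff:
  assumes "basic_sequence q"
  shows "is_cantor_expansion q x E \<longleftrightarrow>
    digit_sequence q E \<and> E 0 = \<lfloor>x\<rfloor> \<and> x = tail_sum q E 0 + of_int (E 0)"
proof (cases "digit_sequence q E")
  case True
  then interpret digit_sequence q E .
  have "(\<lambda>n. of_int (E (Suc n)) / qprod q (Suc n)) sums (x - of_int (E 0)) \<longleftrightarrow>
      x = tail_sum q E 0 + of_int (E 0)" (is "?f sums _ \<longleftrightarrow> _")
  proof -
    have "?f sums tail_sum q E 0"
      using summable_sums[OF summable_tail[of 0]] by (simp add: tail_sum_def)
    then have "?f sums (x - of_int (E 0)) \<longleftrightarrow> tail_sum q E 0 = x - of_int (E 0)"
      using sums_unique2 by metis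
    then show ?thesis by linarith
  qed
  then show ?thesis
    unfolding is_cantor_expansion_def qprod_def[symmetric] using True range inf by blast
next
  case False
  then show ?thesis
    using assms unfolding is_cantor_expansion_def digit_sequence_def by blast
qed

text \<open>The orbit point \<open>frac (qprod q n * x)\<close> depends on \<open>x\<close> only,
  and digit \<open>Suc n\<close> is the floor of \<open>q (Suc n)\<close> times this point.\<close>

lemma cantor_expansion_unique:
  assumes "basic_sequence q" "is_cantor_expansion q x E" "is_cantor_expansion q x E'"
  shows "E = E'"
proof -
  have *: "F (Suc n) = \<lfloor>real (q (Suc n)) * frac (qprod q n * x)\<rfloor>"
    if "is_cantor_expansion q x F" for F n
  proof -
    interpret digit_sequence q F using that is_cantor_expansion_iff[OF assms(1)] by blast
    have x: "x = tail_sum q F 0 + of_int (F 0)" using that is_cantor_expansion_iff[OF assms(1)] by blast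
    show ?thesis unfolding x frac_qprod_value by (rule digit_eq_floor)
  qed
  have "E 0 = E' 0" using assms(2,3) by (simp add: is_cantor_expansion_def)
  moreover have "E (Suc n) = E' (Suc n)" for n using *[OF assms(2)] *[OF assms(3)] by simp
  ultimately have "E n = E' n" for n by (cases n) simp_all
  then show ?thesis ..
qed

text \<open>The value of the series has these digits by uniqueness. The interval records that the
  orbit point is a scaled tail: its leading digit fixes it up to
  \<open>1 / q (Suc n)\<close>.\<close>

lemma (in digit_sequence) value_exists:
  "\<exists>x. (\<forall>n\<ge>1. cantor_digit q x n = E n) \<and>
    (\<forall>n. frac (qprod q n * x)
      \<in> {of_int (E (Suc n)) / real (q (Suc n))..(of_int (E (Suc n)) + 1) / real (q (Suc n))})"
proof -
  \<comment> \<open>Integer part 0 makes the tail sum in [0,1) the represented number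
    itself.\<close>
  define E0 where "E0 = E(0 := 0)"
  interpret E0: digit_sequence q E0
  proof
    show "infinite {n. n \<ge> 1 \<and> E0 n \<noteq> int (q n) - 1}"
    proof -
      have "{n. n \<ge> 1 \<and> E0 n \<noteq> int (q n) - 1} = {n. n \<ge> 1 \<and> E n \<noteq> int (q n) - 1}"
        by (auto simp: E0_def)
      then show ?thesis using inf by simp
    qed
  qed (use q range in \<open>auto simp: E0_def\<close>)
  define x where "x = tail_sum q E0 0"
  have E0_0: "E0 0 = 0" by (simp add: E0_def)
  have "is_cantor_expansion q x E0"
    using q E0.digit_sequence_axioms E0.scaled_tail_sum_in_unit[of 0]
    by (simp add: is_cantor_expansion_iff x_def E0_0 floor_eq_iff)
  then have dig: "cantor_digit q x = E0"
    unfolding cantor_digit_def by (intro the_equality) (auto intro: cantor_expansion_unique[OF q])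
  have fr: "frac (qprod q n * x) = qprod q n * tail_sum q E0 n" for n
    using E0.frac_qprod_value[of n 0] by (simp add: x_def)
  have E0_Suc: "E0 (Suc n) = E (Suc n)" for n by (simp add: E0_def)
  have scaled: "real (q (Suc n)) * frac (qprod q n * x)
      \<in> {of_int (E (Suc n))..of_int (E (Suc n)) + 1}" for n
    using E0.scaled_frac_eq[of n] E0.scaled_tail_sum_in_unit[of "Suc n"]
    by (simp add: fr E0_Suc)
  show ?thesis
  proof (intro exI[of _ x] conjI allI impI)
    fix n :: nat assume "n \<ge> 1" then show "cantor_digit q x n = E n" by (simp add: dig E0_def)
  next
    fix n
    show "frac (qprod q n * x)
      \<in> {of_int (E (Suc n)) / real (q (Suc n))..(of_int (E (Suc n)) + 1) / real (q (Suc n))}"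
      using scaled[of n] basic_sequence_pos[OF q, of n] by (simp add: field_simps)
  qed
qed

section \<open>Uniform distribution and block counts\<close>

text \<open>From some \<open>N0\<close> on the fractional parts differ by less than
  \<open>\<delta>\<close>. Up to \<open>N0\<close> indices, the count for [a,b) then lies between
  the counts of \<open>v\<close> for the interval shrunk and enlarged by
  \<open>\<delta>\<close>.\<close>

lemma uniformly_distributed_mod_1_perturb:
  assumes v: "uniformly_distributed_mod_1 v"
    and close: "(\<lambda>n. frac (u n) - frac (v n)) \<longlonglongrightarrow> 0"
  shows "uniformly_distributed_mod_1 u"
  unfolding uniformly_distributed_mod_1_def
proof (intro allI impI)
  fix a b :: real assume ab: "0 \<le> a \<and> a < b \<and> b \<le> 1"
  define U where "U N = {n. n < N \<and> a \<le> frac (u n) \<and> frac (u n) < b}" for N :: nat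
  define V where "V c d N = {n. n < N \<and> c \<le> frac (v n) \<and> frac (v n) < d}" for c d and N :: nat
  have V: "(\<lambda>N. real (card (V c d N)) / real N) \<longlonglongrightarrow> d - c" if "0 \<le> c" "c < d" "d \<le> 1" for c d
    using v that unfolding uniformly_distributed_mod_1_def V_def by blast
  have fin: "finite (U N)" "finite (V c d N)" for N c d
    unfolding U_def V_def by auto
  have N0: "\<exists>N0. \<forall>n\<ge>N0. \<bar>frac (u n) - frac (v n)\<bar> < \<delta>" if "\<delta> > 0" for \<delta>
    using LIMSEQ_D[OF close that] by auto
  show "(\<lambda>N. real (card (U N)) / real N) \<longlonglongrightarrow> b - a"
  proof (rule order_tendstoI)
    fix r assume r: "r < b - a"
    \<comment> \<open>The second argument of \<open>min\<close> keeps the shrunk interval nonempty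
      when \<open>r\<close> is negative.\<close>
    define \<delta> where "\<delta> = min (b - a - r) (b - a) / 4"
    have \<delta>: "\<delta> > 0" "a + \<delta> < b - \<delta>" "r < b - a - 2 * \<delta>"
      using r ab by (auto simp: \<delta>_def min_def field_simps)
    obtain N0 where N0: "\<And>n. n \<ge> N0 \<Longrightarrow> \<bar>frac (u n) - frac (v n)\<bar> < \<delta>" using N0 \<delta> by blast
    have "card (V (a + \<delta>) (b - \<delta>) N) \<le> card (U N) + N0" for N
    proof -
      have "V (a + \<delta>) (b - \<delta>) N \<subseteq> U N \<union> {..<N0}"
      proof
        fix n assume "n \<in> V (a + \<delta>) (b - \<delta>) N"
        then show "n \<in> U N \<union> {..<N0}" using N0[of n] by (fastforce simp: U_def V_def not_less)
      qed
      then have "card (V (a + \<delta>) (b - \<delta>) N) \<le> card (U N \<union> {..<N0})" using fin by (intro card_mono) auto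
      also have "\<dots> \<le> card (U N) + N0" using card_Un_le[of "U N" "{..<N0}"] by simp
      finally show ?thesis .
    qed
    then have *: "real (card (V (a + \<delta>) (b - \<delta>) N)) \<le> real (card (U N)) + real N0" for N
      by (simp flip: of_nat_add)
    have le: "real (card (V (a + \<delta>) (b - \<delta>) N)) / real N - real N0 / real N \<le> real (card (U N)) / real N" for N
      using divide_right_mono[OF *[of N], of "real N"] by (simp add: add_divide_distrib)
    have "(\<lambda>N. real (card (V (a + \<delta>) (b - \<delta>) N)) / real N - real N0 / real N) \<longlonglongrightarrow> (b - \<delta> - (a + \<delta>)) - 0"
      using \<delta> ab by (intro tendsto_diff V lim_const_over_n) auto
    then have "eventually (\<lambda>N. r < real (card (V (a + \<delta>) (b - \<delta>) N)) / real N - real N0 / real N) sequentially"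
      by (rule order_tendstoD) (use \<delta> in simp)
    then show "eventually (\<lambda>N. r < real (card (U N)) / real N) sequentially"
      by eventually_elim (use le less_le_trans in blast)
  next
    fix r assume r: "b - a < r"
    define \<delta> where "\<delta> = (r - (b - a)) / 4"
    have \<delta>: "\<delta> > 0" "b - a + 2 * \<delta> < r" using r by (auto simp: \<delta>_def field_simps)
    \<comment> \<open>Clipping to [0,1] loses no point, since fractional parts lie in [0,1).\<close>
    define c where "c = max 0 (a - \<delta>)"
    define d where "d = min 1 (b + \<delta>)"
    have cd: "0 \<le> c" "c < d" "d \<le> 1" "d - c < r" using \<delta> ab by (auto simp: c_def d_def)
    obtain N0 where N0: "\<And>n. n \<ge> N0 \<Longrightarrow> \<bar>frac (u n) - frac (v n)\<bar> < \<delta>" using N0 \<delta> by blast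
    have "card (U N) \<le> card (V c d N) + N0" for N
    proof -
      have "U N \<subseteq> V c d N \<union> {..<N0}"
      proof
        fix n assume n: "n \<in> U N"
        show "n \<in> V c d N \<union> {..<N0}"
        proof (cases "n < N0")
          case False
          then have "\<bar>frac (u n) - frac (v n)\<bar> < \<delta>" by (intro N0) simp
          then show ?thesis
            using n frac_ge_0[of "v n"] frac_lt_1[of "v n"] by (auto simp: U_def V_def c_def d_def)
        qed simp
      qed
      then have "card (U N) \<le> card (V c d N \<union> {..<N0})" using fin by (intro card_mono) auto
      also have "\<dots> \<le> card (V c d N) + N0" using card_Un_le[of "V c d N" "{..<N0}"] by simp
      finally show ?thesis .
    qed
    then have *: "real (card (U N)) \<le> real (card (V c d N)) + real N0" for N
      by (simp flip: of_nat_add)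
    have le: "real (card (U N)) / real N \<le> real (card (V c d N)) / real N + real N0 / real N" for N
      using divide_right_mono[OF *[of N], of "real N"] by (simp add: add_divide_distrib)
    have "(\<lambda>N. real (card (V c d N)) / real N + real N0 / real N) \<longlonglongrightarrow> (d - c) + 0"
      using cd by (intro tendsto_add V lim_const_over_n) auto
    then have "eventually (\<lambda>N. real (card (V c d N)) / real N + real N0 / real N < r) sequentially"
      by (rule order_tendstoD) (use cd in simp)
    then show "eventually (\<lambda>N. real (card (U N)) / real N < r) sequentially"
      by eventually_elim (use le le_less_trans in blast)
  qed
qed

text \<open>The counterpart of \<open>block_count\<close> for bare digits, so that counting can be
  done before any real number is chosen.\<close>

definition occurrences :: "(nat \<Rightarrow> int) \<Rightarrow> nat list \<Rightarrow> nat \<Rightarrow> nat" where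
  "occurrences E B n = card {m \<in> {1..n}. \<forall>i<length B. E (m + i) = int (B ! i)}"

lemma block_count_eq_occurrences:
  assumes "\<And>n. n \<ge> 1 \<Longrightarrow> cantor_digit q x n = E n"
  shows "block_count q B x n = occurrences E B n"
  unfolding block_count_def occurrences_def by (intro arg_cong[of _ _ card]) (auto simp: assms)

lemma occurrences_eq_sum:
  "real (occurrences E B n) = (\<Sum>p<n. of_bool (\<forall>i<length B. E (Suc p + i) = int (B ! i)))"
proof -
  have "real (occurrences E B n) = (\<Sum>m=1..n. of_bool (\<forall>i<length B. E (m + i) = int (B ! i)))"
    by (simp add: occurrences_def of_bool_def sum.If_cases Int_def)
  also have "\<dots> = (\<Sum>p<n. of_bool (\<forall>i<length B. E (Suc p + i) = int (B ! i)))"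
    by (simp only: One_nat_def sum.atLeast1_atMost_eq)
  finally show ?thesis .
qed

lemma Q_sum_eq_sum: "Q_sum q k n = (\<Sum>p<n. 1 / (\<Prod>i<k. real (q (Suc p + i))))"
  unfolding Q_sum_def by (simp only: One_nat_def sum.atLeast1_atMost_eq)

text \<open>A block involves finitely many digit values, so one \<open>N0\<close> serves them all:
  from there on both sequences show the block at the same positions. The counts differ by at most
  \<open>N0\<close>, which is negligible against \<open>G\<close>.\<close>

lemma occurrences_limit_cong:
  fixes G :: "nat \<Rightarrow> real"
  assumes same: "\<And>d. eventually (\<lambda>n. E n = int d \<longleftrightarrow> E' n = int d) sequentially"
    and G: "filterlim G at_top sequentially"
    and lim: "(\<lambda>n. real (occurrences E B n) / G n) \<longlonglongrightarrow> L"
  shows "(\<lambda>n. real (occurrences E' B n) / G n) \<longlonglongrightarrow> L"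
proof -
  have "eventually (\<lambda>n. \<forall>d\<in>set B. E n = int d \<longleftrightarrow> E' n = int d) sequentially"
    by (rule eventually_ball_finite) (use same in auto)
  then obtain N0 where N0: "\<And>n d. n \<ge> N0 \<Longrightarrow> d \<in> set B \<Longrightarrow> E n = int d \<longleftrightarrow> E' n = int d"
    by (auto simp: eventually_sequentially)
  have le: "occurrences F B n \<le> occurrences F' B n + N0"
    if *: "\<And>n d. n \<ge> N0 \<Longrightarrow> d \<in> set B \<Longrightarrow> F n = int d \<longleftrightarrow> F' n = int d" for F F' n
  proof -
    let ?A = "\<lambda>F. {m \<in> {1..n}. \<forall>i<length B. F (m + i) = int (B ! i)}"
    have "?A F \<subseteq> ?A F' \<union> {..<N0}" using * by (fastforce simp: not_less)
    then have "card (?A F) \<le> card (?A F' \<union> {..<N0})" by (intro card_mono) auto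
    also have "\<dots> \<le> card (?A F') + N0" using card_Un_le[of "?A F'" "{..<N0}"] by simp
    finally show ?thesis by (simp add: occurrences_def)
  qed
  have bound: "\<bar>real (occurrences E' B n) - real (occurrences E B n)\<bar> \<le> real N0" for n
    using le[of E E' n] le[of E' E n] N0 by auto
  have "(\<lambda>n. real (occurrences E' B n) / G n - real (occurrences E B n) / G n) \<longlonglongrightarrow> 0"
  proof (rule Lim_null_comparison)
    show "(\<lambda>n. real N0 / G n) \<longlonglongrightarrow> 0"
      by (rule tendsto_divide_0[OF tendsto_const filterlim_at_top_imp_at_infinity[OF G]])
    have "eventually (\<lambda>n. G n > 0) sequentially" using G by (simp add: filterlim_at_top_dense)
    then show "eventually (\<lambda>n. norm (real (occurrences E' B n) / G n - real (occurrences E B n) / G n)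
        \<le> real N0 / G n) sequentially"
      by eventually_elim (use bound in \<open>simp add: divide_right_mono flip: diff_divide_distrib\<close>)
  qed
  from tendsto_add[OF this lim] show ?thesis by simp
qed

section \<open>A normal and distribution normal digit sequence\<close>

text \<open>Independence of digits: the numbers below \<open>m ^ K\<close> run through all digit
  vectors once. The induction splits off the lowest digit \<open>d\<close> by writing a number as
  \<open>d + i*m\<close>.\<close>

lemma sum_prod_digits:
  fixes h :: "nat \<Rightarrow> nat \<Rightarrow> real"
  assumes "m > 0"
  shows "(\<Sum>i<m ^ K. \<Prod>r<K. h r (i div m ^ r mod m)) = (\<Prod>r<K. \<Sum>d<m. h r d)"
proof (induction K arbitrary: h)
  case (Suc K)
  have "(\<Sum>i<m ^ Suc K. \<Prod>r<Suc K. h r (i div m ^ r mod m))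
      = (\<Sum>i<m ^ K. \<Sum>x=i*m..<i*m+m. \<Prod>r<Suc K. h r (x div m ^ r mod m))"
    by (subst sum.nat_group) (simp add: mult.commute)
  also have "\<dots> = (\<Sum>i<m ^ K. \<Sum>d<m. \<Prod>r<Suc K. h r ((d + i*m) div m ^ r mod m))"
  proof (rule sum.cong[OF refl])
    fix i
    show "(\<Sum>x=i*m..<i*m+m. \<Prod>r<Suc K. h r (x div m ^ r mod m))
        = (\<Sum>d<m. \<Prod>r<Suc K. h r ((d + i*m) div m ^ r mod m))"
      using sum.shift_bounds_nat_ivl[of "\<lambda>x. \<Prod>r<Suc K. h r (x div m ^ r mod m)" 0 "i*m" m]
      by (simp only: lessThan_atLeast0 add_0 add.commute[of m])
  qed
  also have "\<dots> = (\<Sum>i<m ^ K. \<Sum>d<m. h 0 d * (\<Prod>r<K. h (Suc r) (i div m ^ r mod m)))"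
  proof (intro sum.cong refl)
    fix i d assume "d \<in> {..<m}"
    then have d: "d < m" by simp
    have "(d + i*m) div m ^ Suc r = i div m ^ r" for r
      using d by (simp add: div_mult2_eq)
    then show "(\<Prod>r<Suc K. h r ((d + i*m) div m ^ r mod m))
        = h 0 d * (\<Prod>r<K. h (Suc r) (i div m ^ r mod m))"
      using d by (simp add: prod.lessThan_Suc_shift del: prod.lessThan_Suc power_Suc)
  qed
  also have "\<dots> = (\<Sum>d<m. h 0 d) * (\<Sum>i<m ^ K. \<Prod>r<K. h (Suc r) (i div m ^ r mod m))"
    by (simp add: sum_product sum_distrib_left sum_distrib_right mult.commute)
  also have "\<dots> = (\<Prod>r<Suc K. \<Sum>d<m. h r d)"
    by (simp add: Suc.IH[of "\<lambda>r. h (Suc r)"] prod.lessThan_Suc_shift del: prod.lessThan_Suc)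
  finally show ?case .
qed simp

text \<open>The factors at the \<open>K - 1\<close> positions other than \<open>j\<close> are
  constantly 1 and contribute \<open>m\<close> each.\<close>

lemma sum_single_digit:
  fixes g :: "nat \<Rightarrow> real"
  assumes "m > 0" "j < K"
  shows "(\<Sum>i<m ^ K. g (i div m ^ j mod m)) = (\<Sum>d<m. g d) * m ^ (K - 1)"
proof -
  let ?h = "\<lambda>r d. if r = j then g d else 1"
  have "(\<Sum>i<m ^ K. g (i div m ^ j mod m)) = (\<Sum>i<m ^ K. \<Prod>r<K. ?h r (i div m ^ r mod m))"
    using assms by (simp add: prod.delta)
  also have "\<dots> = (\<Prod>r<K. \<Sum>d<m. ?h r d)" by (rule sum_prod_digits[OF assms(1)])
  also have "\<dots> = (\<Prod>r<K. if r = j then (\<Sum>d<m. g d) else m)"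
    by (rule prod.cong) auto
  also have "\<dots> = (\<Sum>d<m. g d) * m ^ (K - 1)"
    using assms by (simp add: prod.delta_remove prod.remove[of "{..<K}" j])
  finally show ?thesis .
qed

text \<open>Indicator factors inside the window contribute 1 each, constant factors outside it
  contribute \<open>m\<close> each.\<close>

lemma count_digit_window:
  assumes m: "m > 0" and jk: "j + length B \<le> K" and B: "\<And>r. r < length B \<Longrightarrow> B ! r < m"
  shows "(\<Sum>i<m ^ K. of_bool (\<forall>r<length B. i div m ^ (j + r) mod m = B ! r) :: real)
         = real m ^ (K - length B)"
proof -
  let ?k = "length B"
  let ?I = "{j..<j + ?k}"
  define h :: "nat \<Rightarrow> nat \<Rightarrow> real" where "h r d = (if r \<in> ?I then of_bool (d = B ! (r - j)) else 1)" for r d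
  have "(\<Prod>r<K. h r (i div m ^ r mod m)) = of_bool (\<forall>r<?k. i div m ^ (j + r) mod m = B ! r)" for i
  proof -
    have "(\<Prod>r<K. h r (i div m ^ r mod m)) = (\<Prod>r\<in>?I. h r (i div m ^ r mod m))"
      using jk by (intro prod.mono_neutral_right) (auto simp: h_def)
    also have "\<dots> = (\<Prod>r<?k. h (j + r) (i div m ^ (j + r) mod m))"
      using prod.shift_bounds_nat_ivl[of "\<lambda>r. h r (i div m ^ r mod m)" 0 j ?k]
      by (simp add: lessThan_atLeast0 add.commute)
    also have "\<dots> = (\<Prod>r<?k. of_bool (i div m ^ (j + r) mod m = B ! r))"
      by (rule prod.cong) (auto simp: h_def)
    also have "\<dots> = of_bool (\<forall>r<?k. i div m ^ (j + r) mod m = B ! r)"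
      by (auto simp: of_bool_def prod_zero_iff)
    finally show ?thesis .
  qed
  then have "(\<Sum>i<m ^ K. of_bool (\<forall>r<?k. i div m ^ (j + r) mod m = B ! r) :: real)
      = (\<Sum>i<m ^ K. \<Prod>r<K. h r (i div m ^ r mod m))" by simp
  also have "\<dots> = (\<Prod>r<K. \<Sum>d<m. h r d)" by (rule sum_prod_digits[OF m])
  also have "\<dots> = (\<Prod>r<K. if r \<in> ?I then 1 else real m)"
  proof (rule prod.cong)
    fix r show "(\<Sum>d<m. h r d) = (if r \<in> ?I then 1 else real m)"
    proof (cases "r \<in> ?I")
      case True
      then have "B ! (r - j) < m" by (intro B) auto
      then show ?thesis using True by (simp add: h_def of_bool_def sum.delta)
    next
      case False
      then have "h r d = 1" for d unfolding h_def by (rule if_not_P)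
      then show ?thesis using False by (simp del: atLeastLessThan_iff)
    qed
  qed simp
  also have "\<dots> = (\<Prod>r\<in>{..<K} - ?I. real m)"
    by (rule prod.mono_neutral_cong_right) auto
  also have "\<dots> = real m ^ (K - ?k)"
  proof -
    have "card ({..<K} - ?I) = K - ?k" using jk by (subst card_Diff_subset) auto
    then show ?thesis by simp
  qed
  finally show ?thesis .
qed

text \<open>The length of the concatenation of all \<open>m ^ (m ^ m)\<close> words of length \<open>m ^ m\<close> over \<open>m\<close>
  letters. The word length is chosen to dominate \<open>m ^ k\<close> for every fixed \<open>k\<close>, so that the
  uncontrolled occurrences of a block across the border of two words are negligible.\<close>

definition period :: "nat \<Rightarrow> nat" where
  "period m = m ^ m * m ^ (m ^ m)"

section \<open>The concatenation of all words over slowly growing alphabets\<close>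

text \<open>Chunk \<open>c\<close> has the alphabet size \<open>s c\<close>. By \<open>slow\<close>
  its length is at most \<open>(c + C) / s c\<close>, which is small compared with the number of
  chunks before it.\<close>

locale all_words =
  fixes s :: "nat \<Rightarrow> nat" and C :: nat
  assumes s_ge: "2 \<le> s c"
    and slow: "period (s c) * s c \<le> c + C"
    and s_lim: "filterlim s at_top sequentially"
begin

lemma s_pos: "s c > 0"
  using s_ge[of c] by simp

sublocale chunks "\<lambda>c. period (s c)"
  by unfold_locales (simp add: period_def s_pos)

abbreviation word_len :: "nat \<Rightarrow> nat" where "word_len c \<equiv> s c ^ s c"

abbreviation num_words :: "nat \<Rightarrow> nat" where "num_words c \<equiv> s c ^ word_len c"

text \<open>Sequence indices start at 1 and positions in \<open>chunk\<close> at 0. At index 0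
  truncated subtraction repeats the value at 1, so bounds hold at every index.\<close>

definition base :: "nat \<Rightarrow> nat" where
  "base n = s (chunk (n - 1))"

text \<open>Letter \<open>j\<close> of the \<open>i\<close>-th word in chunk \<open>c\<close> is the \<open>j\<close>-th digit of \<open>i\<close> in base \<open>s c\<close>.\<close>

definition digit :: "nat \<Rightarrow> nat" where
  "digit n = (let c = chunk (n - 1); i = n - 1 - start c
     in i div word_len c div s c ^ (i mod word_len c) mod s c)"

text \<open>The bound on \<open>j + r\<close> keeps the index inside word \<open>i\<close>, hence
  inside chunk \<open>c\<close>, where the base is constant.\<close>

lemma letter:
  assumes "i < num_words c" "j + r < word_len c"
  shows "base (Suc (start c + (i * word_len c + j)) + r) = s c"
    and "digit (Suc (start c + (i * word_len c + j)) + r) = i div s c ^ (j + r) mod s c"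
proof -
  have "i * word_len c + (j + r) < Suc i * word_len c" using assms(2) by simp
  also have "\<dots> \<le> num_words c * word_len c" using assms(1) by (intro mult_right_mono) auto
  finally have *: "i * word_len c + (j + r) < period (s c)" by (simp add: period_def mult.commute)
  have pos: "Suc (start c + (i * word_len c + j)) + r - 1 = start c + (i * word_len c + (j + r))" by simp
  note ch = chunk_eq[OF *]
  show "base (Suc (start c + (i * word_len c + j)) + r) = s c"
    unfolding base_def pos ch ..
  show "digit (Suc (start c + (i * word_len c + j)) + r) = i div s c ^ (j + r) mod s c"
    unfolding digit_def pos ch Let_def using assms(2) s_pos[of c] by simp
qed

text \<open>The sum is regrouped by the position \<open>j\<close> inside a word. All but at most
  \<open>k\<close> positions give exactly \<open>V\<close>; each of the others is off by at most the
  number of words.\<close>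

lemma chunk_sum_error:
  fixes f :: "nat \<Rightarrow> real" and V :: real
  assumes f: "\<And>p. 0 \<le> f p" "\<And>p. f p \<le> 1" and V: "0 \<le> V" "V \<le> num_words c"
    and good: "\<And>j. j < word_len c \<Longrightarrow> j + k \<le> word_len c \<Longrightarrow>
      (\<Sum>i<num_words c. f (start c + (i * word_len c + j))) = V"
  shows "\<bar>(\<Sum>i<period (s c). f (start c + i)) - word_len c * V\<bar> \<le> k * num_words c"
proof -
  define S where "S j = (\<Sum>i<num_words c. f (start c + (i * word_len c + j)))" for j
  have S: "0 \<le> S j" "S j \<le> num_words c" for j
    using f sum_bounded_above[of "{..<num_words c}" "\<lambda>i. f (start c + (i * word_len c + j))" 1]
    by (auto simp: S_def intro: sum_nonneg)
  have "(\<Sum>i<period (s c). f (start c + i))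
      = (\<Sum>i<num_words c. \<Sum>x=i * word_len c..<i * word_len c + word_len c. f (start c + x))"
    by (subst sum.nat_group) (simp add: period_def mult.commute)
  also have "\<dots> = (\<Sum>i<num_words c. \<Sum>j<word_len c. f (start c + (i * word_len c + j)))"
  proof (rule sum.cong[OF refl])
    fix i
    show "(\<Sum>x=i * word_len c..<i * word_len c + word_len c. f (start c + x))
        = (\<Sum>j<word_len c. f (start c + (i * word_len c + j)))"
      using sum.shift_bounds_nat_ivl[of "\<lambda>x. f (start c + x)" 0 "i * word_len c" "word_len c"]
      by (simp only: lessThan_atLeast0 add_0 add.commute)
  qed
  also have "\<dots> = (\<Sum>j<word_len c. S j)" unfolding S_def by (rule sum.swap)
  finally have "(\<Sum>i<period (s c). f (start c + i)) - word_len c * V = (\<Sum>j<word_len c. S j - V)"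
    by (simp add: sum_subtractf)
  also have "\<bar>\<dots>\<bar> \<le> (\<Sum>j<word_len c. \<bar>S j - V\<bar>)" by (rule sum_abs)
  also have "\<dots> \<le> (\<Sum>j<word_len c. if j + k \<le> word_len c then 0 else real (num_words c))"
  proof (rule sum_mono)
    fix j assume j: "j \<in> {..<word_len c}"
    show "\<bar>S j - V\<bar> \<le> (if j + k \<le> word_len c then 0 else real (num_words c))"
    proof (cases "j + k \<le> word_len c")
      case True
      then have "S j = V" using good[of j] j by (simp add: S_def)
      then show ?thesis using True by simp
    next
      case False
      then show ?thesis using S[of j] V unfolding if_not_P[OF False] by linarith
    qed
  qed
  also have "\<dots> = card {j \<in> {..<word_len c}. \<not> j + k \<le> word_len c} * num_words c"
    by (simp add: sum.If_cases Int_def Collect_neg_eq)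
  also have "\<dots> \<le> k * num_words c"
  proof -
    have "{j \<in> {..<word_len c}. \<not> j + k \<le> word_len c} \<subseteq> {word_len c - k..<word_len c}" by auto
    then have "card {j \<in> {..<word_len c}. \<not> j + k \<le> word_len c} \<le> card {word_len c - k..<word_len c}"
      by (intro card_mono) auto
    then have "card {j \<in> {..<word_len c}. \<not> j + k \<le> word_len c} \<le> k" by simp
    then show ?thesis by (intro of_nat_mono mult_right_mono) auto
  qed
  finally show ?thesis by simp
qed

text \<open>The expected number of occurrences in chunk \<open>c\<close> of a block of length \<open>k\<close>.\<close>

definition weight :: "nat \<Rightarrow> nat \<Rightarrow> real" where
  "weight k c = period (s c) / s c ^ k"

lemma weight_pos: "weight k c > 0"
  using s_pos[of c] by (simp add: weight_def period_def)

lemma eventually_s_ge: "eventually (\<lambda>c. s c \<ge> M) sequentially"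
  using s_lim by (simp add: filterlim_at_top)

text \<open>Once \<open>s c \<ge> k\<close>, the period is at least \<open>s c ^ k\<close>, so every
  further chunk has weight at least 1.\<close>

lemma weight_sum_lower: "\<exists>c0. \<forall>n. real n - real c0 \<le> (\<Sum>c<n. weight k c)"
proof -
  obtain c0 where c0: "\<And>c. c \<ge> c0 \<Longrightarrow> s c \<ge> k"
    using eventually_s_ge[of k] by (auto simp: eventually_sequentially)
  have ge1: "weight k c \<ge> 1" if "c \<ge> c0" for c
  proof -
    have "s c ^ k \<le> s c ^ s c" using c0[OF that] s_pos[of c] by (intro power_increasing) auto
    also have "\<dots> \<le> period (s c)" using s_pos[of c] by (simp add: period_def)
    finally have "real (s c ^ k) \<le> real (period (s c))" by (rule of_nat_mono)
    then show ?thesis using s_pos[of c] by (simp add: weight_def)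
  qed
  have "real n - real c0 \<le> (\<Sum>c<n. weight k c)" for n
  proof (induction n)
    case (Suc n)
    show ?case
    proof (cases "n < c0")
      case True
      then have "real (Suc n) - real c0 \<le> 0" by simp
      also have "0 \<le> (\<Sum>c<Suc n. weight k c)" by (intro sum_nonneg less_imp_le weight_pos)
      finally show ?thesis .
    next
      case False
      then show ?thesis using Suc ge1[of n] by simp
    qed
  qed simp
  then show ?thesis by blast
qed

lemma weight_sum_at_top: "filterlim (\<lambda>n. \<Sum>c<n. weight k c) at_top sequentially"
proof -
  obtain c0 where c0: "\<And>n. real n - real c0 \<le> (\<Sum>c<n. weight k c)" using weight_sum_lower by blast
  show ?thesis
  proof (rule filterlim_at_top_mono)
    show "filterlim (\<lambda>n. - real c0 + real n) at_top sequentially"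
      by (rule filterlim_tendsto_add_at_top[OF tendsto_const filterlim_real_sequentially])
    show "eventually (\<lambda>n. - real c0 + real n \<le> (\<Sum>c<n. weight k c)) sequentially"
      using c0 by (intro always_eventually allI) (simp add: algebra_simps)
  qed
qed

lemma inverse_s_lim: "(\<lambda>c. r / real (s c)) \<longlonglongrightarrow> 0"
  by (intro tendsto_divide_0[OF tendsto_const] filterlim_at_top_imp_at_infinity
      filterlim_compose[OF filterlim_real_sequentially s_lim])

lemma weight_small: "(\<lambda>n. weight k n / (\<Sum>c<n. weight k c)) \<longlonglongrightarrow> 0"
proof -
  obtain c0 where c0: "\<And>n. real n - real c0 \<le> (\<Sum>c<n. weight k c)" using weight_sum_lower by blast
  \<comment> \<open>The threshold yields \<open>n + C \<le> 2 * (n - c0)\<close>, which turns the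
    bound from \<open>slow\<close> into one by the sum of weights; its last summand makes
    \<open>n\<close> positive.\<close>
  have "norm (weight k n / (\<Sum>c<n. weight k c)) \<le> 2 / s n" if n: "n \<ge> 2 * c0 + C + 1" for n
  proof -
    let ?W = "\<Sum>c<n. weight k c"
    have nW: "n + C \<le> 2 * ?W" using c0[of n] n by linarith
    moreover have "real n + C > 0" using n by simp
    ultimately have W: "?W > 0" by linarith
    have "real (s n) ^ k \<ge> 1" using s_pos[of n] by simp
    then have "weight k n \<le> period (s n)"
      by (simp add: weight_def divide_le_eq mult_left_mono[of 1 "real (s n) ^ k" "real (period (s n))", simplified])
    then have "weight k n * s n \<le> period (s n) * s n" by (simp add: mult_right_mono)
    also have "\<dots> \<le> n + C" using slow[of n] by (simp flip: of_nat_mult of_nat_add)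
    also note nW
    finally have "weight k n * s n \<le> 2 * ?W" .
    then have "weight k n / ?W \<le> 2 / s n" using W s_pos[of n] by (simp add: field_simps)
    then show ?thesis using weight_pos[of k n] W by simp
  qed
  then have "eventually (\<lambda>n. norm (weight k n / (\<Sum>c<n. weight k c)) \<le> 2 / s n) sequentially"
    by (auto simp: eventually_sequentially)
  then show ?thesis by (rule Lim_null_comparison) (rule inverse_s_lim)
qed

text \<open>The common tool for \<open>Q_sum\<close>, block counts and uniform distribution: it
  leaves only the main term to be computed, from positions whose window of length \<open>k\<close>
  fits into a word. Relative to the weight, the border error is at most \<open>k / s c\<close> once
  \<open>s c > k\<close>.\<close>

lemma partial_sum_limit:
  fixes f :: "nat \<Rightarrow> real" and V :: "nat \<Rightarrow> real"
  assumes f: "\<And>p. 0 \<le> f p" "\<And>p. f p \<le> 1"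
    and V: "\<And>c. 0 \<le> V c" "\<And>c. V c \<le> num_words c"
    and good: "eventually (\<lambda>c. \<forall>j. j < word_len c \<longrightarrow> j + k \<le> word_len c \<longrightarrow>
      (\<Sum>i<num_words c. f (start c + (i * word_len c + j))) = V c) sequentially"
    and lim: "(\<lambda>c. word_len c * V c / weight k c) \<longlonglongrightarrow> L"
  shows "(\<lambda>n. (\<Sum>p<n. f p) / (\<Sum>c<chunk n. weight k c)) \<longlonglongrightarrow> L"
proof (rule partial_sums_ratio[OF f(1) weight_pos weight_sum_at_top weight_small])
  let ?S = "\<lambda>c. \<Sum>i<period (s c). f (start c + i)"
  have "(\<lambda>c. ?S c / weight k c - word_len c * V c / weight k c) \<longlonglongrightarrow> 0"
  proof (rule Lim_null_comparison)
    show "(\<lambda>c. real k / s c) \<longlonglongrightarrow> 0" by (rule inverse_s_lim)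
    show "eventually (\<lambda>c. norm (?S c / weight k c - word_len c * V c / weight k c) \<le> real k / s c) sequentially"
      using good eventually_s_ge[of "k + 1"]
    proof eventually_elim
      case (elim c)
      have m: "real (s c) > 0" using s_pos[of c] by simp
      have "\<bar>?S c - word_len c * V c\<bar> \<le> k * num_words c"
        by (rule chunk_sum_error[OF f V]) (use elim in auto)
      then have "\<bar>?S c - word_len c * V c\<bar> / weight k c \<le> k * num_words c / weight k c"
        using weight_pos[of k c] by (simp add: divide_right_mono)
      also have "\<dots> = k * (real (s c) ^ k / real (s c) ^ s c)"
        using m by (simp add: weight_def period_def)
      also have "\<dots> \<le> k * (1 / s c)"
      proof (rule mult_left_mono)
        have "s c ^ (k + 1) \<le> s c ^ s c" using elim(2) s_pos[of c] by (intro power_increasing) auto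
        then have "real (s c ^ (k + 1)) \<le> real (s c ^ s c)" by (rule of_nat_mono)
        then show "real (s c) ^ k / real (s c) ^ s c \<le> 1 / s c"
          using m by (simp add: field_simps)
      qed simp
      finally show ?case using weight_pos[of k c]
        by (simp add: abs_divide flip: diff_divide_distrib)
    qed
  qed
  from tendsto_add[OF this lim] show "(\<lambda>c. ?S c / weight k c) \<longlonglongrightarrow> L" by simp
qed

lemma partial_sum_ratio_limit:
  assumes "(\<lambda>n. F n / (\<Sum>c<chunk n. weight k c)) \<longlonglongrightarrow> L"
    and "(\<lambda>n. G n / (\<Sum>c<chunk n. weight k c)) \<longlonglongrightarrow> 1"
  shows "(\<lambda>n. F n / G n) \<longlonglongrightarrow> L"
  by (rule quotient_limit[OF filterlim_compose[OF weight_sum_at_top filterlim_chunk] assms])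

lemma base_ge: "2 \<le> base n"
  unfolding base_def by (rule s_ge)

lemma digit_less: "digit n < base n"
  unfolding digit_def base_def Let_def using s_pos by simp

lemma base_at_top: "filterlim base at_top sequentially"
proof -
  have "filterlim (\<lambda>n. n - 1) at_top (sequentially :: nat filter)"
    by (rule filterlim_minus_const_nat_at_top)
  then show ?thesis
    unfolding base_def by (intro filterlim_compose[OF s_lim] filterlim_compose[OF filterlim_chunk])
qed

text \<open>Away from word borders all \<open>k\<close> factors equal \<open>s c\<close>, so each
  term is \<open>1 / s c ^ k\<close>.\<close>

lemma Q_sum_weight: "(\<lambda>n. Q_sum base k n / (\<Sum>c<chunk n. weight k c)) \<longlonglongrightarrow> 1"
  unfolding Q_sum_eq_sum
proof (rule partial_sum_limit[where V = "\<lambda>c. num_words c / s c ^ k"])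
  show "0 \<le> 1 / (\<Prod>i<k. real (base (Suc p + i)))" for p by (simp add: prod_nonneg)
  have "1 \<le> real (base n)" for n using base_ge[of n] by simp
  then have "1 \<le> (\<Prod>i<k. real (base (Suc p + i)))" for p by (intro prod_ge_1)
  then show "1 / (\<Prod>i<k. real (base (Suc p + i))) \<le> 1" for p
  proof -
    have "1 \<le> (\<Prod>i<k. real (base (Suc p + i)))" (is "_ \<le> ?P") by fact
    then have "0 < ?P" by linarith
    then show ?thesis using \<open>1 \<le> ?P\<close> by (simp only: divide_le_eq_1_pos)
  qed
  show "real (num_words c) / real (s c ^ k) \<le> real (num_words c)" for c
  proof -
    have "1 \<le> real (s c ^ k)" using s_pos[of c] by simp
    then show ?thesis using s_pos[of c] by (simp add: divide_le_eq)
  qed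
  show "eventually (\<lambda>c. \<forall>j. j < word_len c \<longrightarrow> j + k \<le> word_len c \<longrightarrow>
      (\<Sum>i<num_words c. 1 / (\<Prod>r<k. real (base (Suc (start c + (i * word_len c + j)) + r))))
        = num_words c / s c ^ k) sequentially"
  proof (intro always_eventually allI impI)
    fix c j assume "j + k \<le> word_len c"
    have "1 / (\<Prod>r<k. real (base (Suc (start c + (i * word_len c + j)) + r))) = 1 / s c ^ k"
      if "i < num_words c" for i
    proof -
      have "base (Suc (start c + (i * word_len c + j)) + r) = s c" if "r < k" for r
        using \<open>i < num_words c\<close> \<open>j + k \<le> word_len c\<close> that by (intro letter(1)) auto
      then have "(\<Prod>r<k. real (base (Suc (start c + (i * word_len c + j)) + r))) = (\<Prod>r<k. real (s c))"
        by (intro prod.cong) auto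
      then show ?thesis by simp
    qed
    then show "(\<Sum>i<num_words c. 1 / (\<Prod>r<k. real (base (Suc (start c + (i * word_len c + j)) + r))))
        = num_words c / s c ^ k" by simp
  qed
  have "word_len c * (num_words c / s c ^ k) / weight k c = 1" for c
    using s_pos[of c] by (simp add: weight_def period_def)
  then show "(\<lambda>c. word_len c * (num_words c / s c ^ k) / weight k c) \<longlonglongrightarrow> 1"
    by (simp only: tendsto_const)
qed simp

lemma Q_sum_at_top: "filterlim (Q_sum base k) at_top sequentially"
proof -
  let ?W = "\<lambda>n. \<Sum>c<chunk n. weight k c"
  have W: "filterlim ?W at_top sequentially"
    by (rule filterlim_compose[OF weight_sum_at_top filterlim_chunk])
  have "filterlim (\<lambda>n. Q_sum base k n / ?W n * ?W n) at_top sequentially"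
    by (rule filterlim_tendsto_pos_mult_at_top[OF Q_sum_weight _ W]) simp
  moreover have "eventually (\<lambda>n. ?W n > 0) sequentially" using W by (simp add: filterlim_at_top_dense)
  then have "eventually (\<lambda>n. Q_sum base k n / ?W n * ?W n = Q_sum base k n) sequentially"
    by eventually_elim simp
  ultimately show ?thesis by (simp cong: filterlim_cong)
qed

lemma occurrences_limit:
  "(\<lambda>n. real (occurrences (\<lambda>n. int (digit n)) B n) / Q_sum base (length B) n) \<longlonglongrightarrow> 1"
proof (rule partial_sum_ratio_limit[OF _ Q_sum_weight])
  let ?k = "length B"
  show "(\<lambda>n. real (occurrences (\<lambda>n. int (digit n)) B n) / (\<Sum>c<chunk n. weight ?k c)) \<longlonglongrightarrow> 1"
    unfolding occurrences_eq_sum of_nat_eq_iff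
  proof (rule partial_sum_limit[where V = "\<lambda>c. s c ^ (word_len c - ?k)"])
    show "real (s c ^ (word_len c - ?k)) \<le> real (num_words c)" for c
      using s_pos[of c] by (intro of_nat_mono power_increasing) auto
    show "eventually (\<lambda>c. \<forall>j. j < word_len c \<longrightarrow> j + ?k \<le> word_len c \<longrightarrow>
      (\<Sum>i<num_words c. of_bool (\<forall>r<?k. digit (Suc (start c + (i * word_len c + j)) + r) = B ! r))
        = real (s c ^ (word_len c - ?k))) sequentially"
      \<comment> \<open>An alphabet larger than the sum of the block contains each of its
        entries.\<close>
      using eventually_s_ge[of "Suc (sum_list B)"]
    proof eventually_elim
      case (elim c)
      show ?case
      proof (intro allI impI)
        fix j assume j: "j + ?k \<le> word_len c"
        have "(\<Sum>i<num_words c. of_bool (\<forall>r<?k. digit (Suc (start c + (i * word_len c + j)) + r) = B ! r) :: real)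
          = (\<Sum>i<num_words c. of_bool (\<forall>r<?k. i div s c ^ (j + r) mod s c = B ! r))"
        proof (intro sum.cong refl arg_cong[of _ _ of_bool])
          fix i assume "i \<in> {..<num_words c}"
          then have "digit (Suc (start c + (i * word_len c + j)) + r) = i div s c ^ (j + r) mod s c"
            if "r < ?k" for r
            using j that by (intro letter(2)) auto
          then show "(\<forall>r<?k. digit (Suc (start c + (i * word_len c + j)) + r) = B ! r)
            \<longleftrightarrow> (\<forall>r<?k. i div s c ^ (j + r) mod s c = B ! r)" by metis
        qed
        also have "\<dots> = real (s c ^ (word_len c - ?k))"
        proof (subst count_digit_window)
          fix r assume "r < ?k"
          then have "B ! r \<le> sum_list B" by (intro member_le_sum_list) auto
          then show "B ! r < s c" using elim by simp
        qed (use j s_pos in auto)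
        finally show "(\<Sum>i<num_words c. of_bool (\<forall>r<?k. digit (Suc (start c + (i * word_len c + j)) + r) = B ! r))
          = real (s c ^ (word_len c - ?k))" .
      qed
    qed
    have "eventually (\<lambda>c. word_len c * real (s c ^ (word_len c - ?k)) / weight ?k c = 1) sequentially"
      using eventually_s_ge[of ?k]
    proof eventually_elim
      case (elim c)
      \<comment> \<open>With \<open>elim\<close> this puts the block length below
        \<open>word_len c\<close>, so the truncated subtraction in the exponent is exact.\<close>
      have "s c < word_len c" using s_ge[of c] by (intro less_exp[THEN less_le_trans] power_mono) auto
      then have "real (s c) ^ (word_len c - ?k) * real (s c) ^ ?k = real (num_words c)"
        using elim by (simp flip: power_add)
      moreover have "real (s c) > 0" using s_pos[of c] by simp
      ultimately show ?case by (simp add: weight_def period_def field_simps)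
    qed
    then show "(\<lambda>c. word_len c * real (s c ^ (word_len c - ?k)) / weight ?k c) \<longlonglongrightarrow> 1"
      by (rule tendsto_eventually)
  qed simp_all
qed

text \<open>For \<open>k = 0\<close> the weight of a chunk is its length, so plain averages fit the
  same scheme.\<close>

lemma card_weight: "(\<lambda>n. real n / (\<Sum>c<chunk n. weight 0 c)) \<longlonglongrightarrow> 1"
proof -
  have "(\<lambda>n. (\<Sum>p<n. 1) / (\<Sum>c<chunk n. weight 0 c)) \<longlonglongrightarrow> 1"
  proof (rule partial_sum_limit[where V = "\<lambda>c. num_words c"])
    have "word_len c * real (num_words c) / weight 0 c = 1" for c
      using s_pos[of c] by (simp add: weight_def period_def)
    then show "(\<lambda>c. word_len c * real (num_words c) / weight 0 c) \<longlonglongrightarrow> 1"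
      by (simp only: tendsto_const)
  qed auto
  then show ?thesis by simp
qed

text \<open>The numerators of the grid points in [a,b) fill the range between two ceilings, whose
  difference is within 1 of \<open>(b - a) * m\<close>.\<close>

lemma card_grid_points:
  fixes a b :: real and m :: nat
  assumes "0 \<le> a" "a < b" "b \<le> 1" "m > 0"
  shows "\<bar>real (card {d. d < m \<and> a \<le> real d / m \<and> real d / m < b}) / m - (b - a)\<bar> \<le> 1 / m"
proof -
  have m: "real m > 0" using assms by simp
  have "b * m \<le> 1 * real m" using assms by (intro mult_right_mono) auto
  then have *: "nat \<lceil>b * m\<rceil> \<le> m" by (simp add: nat_ceiling_le_eq)
  have "d < m \<and> a \<le> real d / m \<and> real d / m < b \<longleftrightarrow> nat \<lceil>a * m\<rceil> \<le> d \<and> d < nat \<lceil>b * m\<rceil>" for d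
  proof -
    have lower: "a \<le> real d / m \<longleftrightarrow> nat \<lceil>a * m\<rceil> \<le> d"
      using m by (simp only: pos_le_divide_eq nat_ceiling_le_eq)
    have upper: "real d / m < b \<longleftrightarrow> d < nat \<lceil>b * m\<rceil>"
      using m nat_ceiling_le_eq[of "b * m" d] by (simp only: pos_divide_less_eq) linarith
    have "d < m" if "d < nat \<lceil>b * m\<rceil>" using that * by (rule less_le_trans)
    then show ?thesis unfolding lower upper by blast
  qed
  then have "card {d. d < m \<and> a \<le> real d / m \<and> real d / m < b} = card {nat \<lceil>a * m\<rceil>..<nat \<lceil>b * m\<rceil>}"
    by (intro arg_cong[of _ _ card] set_eqI) (simp only: mem_Collect_eq atLeastLessThan_iff)
  also have "\<dots> = nat \<lceil>b * m\<rceil> - nat \<lceil>a * m\<rceil>" by simp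
  also have "real \<dots> = real (nat \<lceil>b * m\<rceil>) - real (nat \<lceil>a * m\<rceil>)"
  proof (rule of_nat_diff)
    have "a * m \<le> b * m" using assms by (intro mult_right_mono) auto
    then show "nat \<lceil>a * m\<rceil> \<le> nat \<lceil>b * m\<rceil>" by (intro nat_mono ceiling_mono)
  qed
  also have "\<bar>\<dots> - (b - a) * m\<bar> \<le> 1"
  proof -
    have "0 \<le> a * m" "0 \<le> b * m" using assms by auto
    then have "real (nat \<lceil>a * m\<rceil>) = \<lceil>a * m\<rceil>" "real (nat \<lceil>b * m\<rceil>) = \<lceil>b * m\<rceil>" by auto
    then show ?thesis
      using ceiling_correct[of "a * m"] ceiling_correct[of "b * m"] by (simp add: algebra_simps) linarith
  qed
  finally have "\<bar>(real (card {d. d < m \<and> a \<le> real d / m \<and> real d / m < b}) - (b - a) * m) / m\<bar> \<le> 1 / m"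
    using m by (simp add: abs_divide divide_right_mono)
  moreover have "(x - (b - a) * m) / m = x / m - (b - a)" for x :: real
    using m by (simp add: diff_divide_distrib)
  ultimately show ?thesis by (simp only:)
qed

text \<open>At each position inside a word every letter is equally frequent over the words of a
  chunk, so the quotients run evenly through the grid of mesh \<open>1 / s c\<close>.\<close>

lemma digit_ratio_uniform:
  "uniformly_distributed_mod_1 (\<lambda>n. real (digit (Suc n)) / real (base (Suc n)))"
  unfolding uniformly_distributed_mod_1_def
proof (intro allI impI)
  fix a b :: real assume ab: "0 \<le> a \<and> a < b \<and> b \<le> 1"
  let ?x = "\<lambda>n. real (digit (Suc n)) / real (base (Suc n))"
  let ?D = "\<lambda>m. {d. d < m \<and> a \<le> real d / m \<and> real d / m < b}"
  have fr: "frac (?x n) = ?x n" for n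
    using digit_less[of "Suc n"] by (simp add: frac_eq)
  have "real (card {n. n < N \<and> a \<le> frac (?x n) \<and> frac (?x n) < b})
      = (\<Sum>p<N. of_bool (a \<le> ?x p \<and> ?x p < b))" for N
    unfolding fr by (simp add: of_bool_def sum.If_cases Int_def)
  moreover have "(\<lambda>N. (\<Sum>p<N. of_bool (a \<le> ?x p \<and> ?x p < b)) / real N) \<longlonglongrightarrow> b - a"
  proof (rule partial_sum_ratio_limit[OF _ card_weight])
    show "(\<lambda>n. (\<Sum>p<n. of_bool (a \<le> ?x p \<and> ?x p < b)) / (\<Sum>c<chunk n. weight 0 c)) \<longlonglongrightarrow> b - a"
    proof (rule partial_sum_limit[where V = "\<lambda>c. card (?D (s c)) * s c ^ (word_len c - 1)"])
      have *: "num_words c = s c * s c ^ (word_len c - 1)" for c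
        using s_pos[of c] by (simp flip: power_Suc)
      show "real (card (?D (s c)) * s c ^ (word_len c - 1)) \<le> real (num_words c)" for c
      proof -
        have "card (?D (s c)) \<le> card {..<s c}" by (intro card_mono) auto
        then show ?thesis unfolding * by (intro of_nat_mono mult_right_mono) auto
      qed
      have "(\<Sum>i<num_words c. of_bool (a \<le> ?x (start c + (i * word_len c + j)) \<and> ?x (start c + (i * word_len c + j)) < b))
        = real (card (?D (s c)) * s c ^ (word_len c - 1))" if j: "j < word_len c" for c j
      proof -
        let ?g = "\<lambda>d. of_bool (a \<le> real d / s c \<and> real d / s c < b) :: real"
        have "?x (start c + (i * word_len c + j)) = real (i div s c ^ j mod s c) / s c"
          if "i < num_words c" for i
          using letter[of i c j 0] j that unfolding add_0_right by simp
        then have "(\<Sum>i<num_words c. of_bool (a \<le> ?x (start c + (i * word_len c + j)) \<and> ?x (start c + (i * word_len c + j)) < b))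
          = (\<Sum>i<num_words c. ?g (i div s c ^ j mod s c))"
          by (intro sum.cong refl) (simp only: lessThan_iff)
        also have "\<dots> = (\<Sum>d<s c. ?g d) * s c ^ (word_len c - 1)"
          using j s_pos by (intro sum_single_digit) auto
        also have "(\<Sum>d<s c. ?g d) = card (?D (s c))"
          by (simp add: of_bool_def sum.If_cases Int_def)
        finally show ?thesis by simp
      qed
      then show "eventually (\<lambda>c. \<forall>j. j < word_len c \<longrightarrow> j + 0 \<le> word_len c \<longrightarrow>
        (\<Sum>i<num_words c. of_bool (a \<le> ?x (start c + (i * word_len c + j)) \<and> ?x (start c + (i * word_len c + j)) < b))
        = real (card (?D (s c)) * s c ^ (word_len c - 1))) sequentially"
        by (intro always_eventually allI impI)
      have "word_len c * real (card (?D (s c)) * s c ^ (word_len c - 1)) / weight 0 c = card (?D (s c)) / s c" for c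
        unfolding weight_def period_def * using s_pos[of c] by simp
      moreover have "(\<lambda>c. card (?D (s c)) / s c) \<longlonglongrightarrow> b - a"
      proof (rule LIM_zero_cancel, rule Lim_null_comparison)
        show "eventually (\<lambda>c. norm (card (?D (s c)) / s c - (b - a)) \<le> 1 / s c) sequentially"
          using card_grid_points[of a b] ab s_pos by (intro always_eventually) auto
      qed (rule inverse_s_lim)
      ultimately show "(\<lambda>c. word_len c * real (card (?D (s c)) * s c ^ (word_len c - 1)) / weight 0 c) \<longlonglongrightarrow> b - a"
        by simp
    qed auto
  qed
  ultimately show "(\<lambda>N. real (card {n. n < N \<and> a \<le> frac (?x n) \<and> frac (?x n) < b}) / real N) \<longlonglongrightarrow> b - a"
    by simp
qed

end

section \<open>Summary of the constructed digit sequence\<close>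

locale normal_digits =
  fixes q E :: "nat \<Rightarrow> nat"
  assumes q_ge: "2 \<le> q n" and E_less: "E n < q n"
    and q_lim: "filterlim q at_top sequentially"
    and Q_lim: "filterlim (Q_sum q k) at_top sequentially"
    and occ_lim: "(\<lambda>n. real (occurrences (\<lambda>n. int (E n)) B n) / Q_sum q (length B) n) \<longlonglongrightarrow> 1"
    and uniform: "uniformly_distributed_mod_1 (\<lambda>n. real (E (Suc n)) / real (q (Suc n)))"

lemma normal_digits_exist: "\<exists>q E. normal_digits q E"
proof -
  obtain s where s: "\<And>c. 2 \<le> s c" "\<And>c. period (s c) * s c \<le> c + period 2 * 2"
    "filterlim s at_top sequentially"
    using slow_sequence[of "\<lambda>m. period m * m"] by blast
  interpret all_words s "period 2 * 2" using s by unfold_locales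
  have "normal_digits base digit"
    by unfold_locales (rule base_ge digit_less base_at_top Q_sum_at_top occurrences_limit digit_ratio_uniform)+
  then show ?thesis by blast
qed

section \<open>Containments and their failures\<close>

text \<open>Both counts are asymptotic to the same \<open>Q_sum q k\<close>, which full divergence
  makes positive for large \<open>n\<close>.\<close>

lemma normal_subset_ratio_normal:
  assumes "fully_divergent q"
  shows "normal_numbers q \<subseteq> ratio_normal_numbers q"
proof
  fix x assume x: "x \<in> normal_numbers q"
  show "x \<in> ratio_normal_numbers q"
    unfolding ratio_normal_numbers_def
  proof (intro CollectI allI impI)
    fix k :: nat and B1 B2 :: "nat list"
    assume k: "k \<ge> 1" and B: "length B1 = k \<and> length B2 = k"
    have lim: "(\<lambda>n. real (block_count q B x n) / Q_sum q k n) \<longlonglongrightarrow> 1" if "length B = k" for B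
      using x k that by (auto simp: normal_numbers_def)
    have "filterlim (Q_sum q k) at_top sequentially"
      using assms k by (simp add: fully_divergent_def k_divergent_def)
    then show "(\<lambda>n. real (block_count q B1 x n) / real (block_count q B2 x n)) \<longlonglongrightarrow> 1"
      by (rule quotient_limit) (use B lim in auto)
  qed
qed

text \<open>Edges that introduce ratio normality rest on \<open>normal_subset_ratio_normal\<close>;
  the others are plain set inclusions.\<close>

lemma containment_of_path:
  assumes "(A, B) \<in> G_edges\<^sup>*" "fully_divergent q"
  shows "label_set A q \<subseteq> label_set B q"
  using assms(1)
proof (induction rule: rtrancl_induct)
  case (step B C)
  have "label_set B q \<subseteq> label_set C q"
    using step.hyps(2) normal_subset_ratio_normal[OF assms(2)] by (auto simp: G_edges_def)
  with step.IH show ?case by blast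
qed simp

section \<open>From digit sequences to real numbers\<close>

lemma inverse_lim:
  fixes q :: "nat \<Rightarrow> nat"
  assumes "filterlim q at_top sequentially"
  shows "(\<lambda>n. r / real (q (Suc n))) \<longlonglongrightarrow> 0"
  by (intro tendsto_divide_0[OF tendsto_const] filterlim_at_top_imp_at_infinity
      filterlim_compose[OF filterlim_real_sequentially]
      filterlim_compose[OF assms filterlim_Suc])

text \<open>The orbit stays within \<open>1 / q (Suc n)\<close> of the digit quotients, and this
  bound tends to 0.\<close>

lemma distribution_normal_of_digits:
  assumes q: "\<And>n. 2 \<le> q n" "filterlim q at_top sequentially"
    and E: "\<And>n. E n < q n" "uniformly_distributed_mod_1 (\<lambda>n. real (E (Suc n)) / real (q (Suc n)))"
    and x: "\<And>n. frac (qprod q n * x)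
      \<in> {real (E (Suc n)) / real (q (Suc n))..(real (E (Suc n)) + 1) / real (q (Suc n))}"
  shows "x \<in> distribution_normal_numbers q"
proof -
  have "uniformly_distributed_mod_1 (\<lambda>n. qprod q n * x)"
  proof (rule uniformly_distributed_mod_1_perturb[OF E(2)])
    let ?v = "\<lambda>n. real (E (Suc n)) / real (q (Suc n))"
    have v: "frac (?v n) = ?v n" for n using E(1)[of "Suc n"] by (simp add: frac_eq)
    show "(\<lambda>n. frac (qprod q n * x) - frac (?v n)) \<longlonglongrightarrow> 0"
    proof (rule Lim_null_comparison)
      have "norm (frac (qprod q n * x) - ?v n) \<le> 1 / real (q (Suc n))" for n
        using x[of n] by (simp add: add_divide_distrib algebra_simps)
      then show "eventually (\<lambda>n. norm (frac (qprod q n * x) - frac (?v n)) \<le> 1 / real (q (Suc n))) sequentially"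
        unfolding v by (intro always_eventually allI)
    qed (rule inverse_lim[OF q(2)])
  qed
  then show ?thesis by (simp add: distribution_normal_numbers_def qprod_def)
qed

lemma real_with_digits:
  assumes q: "\<And>n. 2 \<le> q n" and E: "\<And>n. E n < q n" and inf: "infinite {n. E n + 1 \<noteq> q n}"
  shows "\<exists>x. (\<forall>B n. block_count q B x n = occurrences (\<lambda>n. int (E n)) B n) \<and>
    (\<forall>n. frac (qprod q n * x)
      \<in> {real (E (Suc n)) / real (q (Suc n))..(real (E (Suc n)) + 1) / real (q (Suc n))})"
proof -
  interpret digit_sequence q "\<lambda>n. int (E n)"
  proof
    show "basic_sequence q" using q by (simp add: basic_sequence_def)
    show "int (E n) \<in> {0..int (q n) - 1}" for n using E[of n] by simp
    have "{n. n \<ge> 1 \<and> int (E n) \<noteq> int (q n) - 1} = {n. E n + 1 \<noteq> q n} - {0}" by auto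
    then show "infinite {n. n \<ge> 1 \<and> int (E n) \<noteq> int (q n) - 1}" using inf by simp
  qed
  obtain x where x: "\<forall>n\<ge>1. cantor_digit q x n = int (E n)"
    "\<forall>n. frac (qprod q n * x)
      \<in> {of_int (int (E (Suc n))) / real (q (Suc n))..(of_int (int (E (Suc n))) + 1) / real (q (Suc n))}"
    using value_exists by blast
  have "\<forall>B n. block_count q B x n = occurrences (\<lambda>n. int (E n)) B n"
    by (intro allI block_count_eq_occurrences) (use x(1) in blast)
  then show ?thesis using x(2)[unfolded of_int_of_nat_eq] by (intro exI[of _ x] conjI)
qed

lemma admissible_base:
  assumes "\<And>n. 2 \<le> q n" "filterlim q at_top sequentially" "\<And>k. filterlim (Q_sum q k) at_top sequentially"
  shows "basic_sequence q \<and> infinite_in_limit q \<and> fully_divergent q"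
  using assms by (simp add: basic_sequence_def infinite_in_limit_def fully_divergent_def k_divergent_def)

lemma infinite_of_eventually:
  "eventually P (sequentially :: nat filter) \<Longrightarrow> infinite {n. P n}"
proof -
  assume "eventually P sequentially"
  then obtain N where "{N..} \<subseteq> {n. P n}" by (auto simp: eventually_sequentially)
  then show ?thesis using infinite_Ici by (rule infinite_super)
qed

section \<open>The three separating examples\<close>

lemma (in normal_digits) large: "eventually (\<lambda>n. q n > M) sequentially"
  using q_lim[unfolded filterlim_at_top, THEN spec, of "Suc M"] by (simp add: Suc_le_eq)

lemma (in normal_digits) normal_not_distribution_normal:
  "\<exists>q x. basic_sequence q \<and> infinite_in_limit q \<and> fully_divergent q \<and>
    x \<in> normal_numbers q \<and> x \<notin> distribution_normal_numbers q"
proof -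
  define F where "F n = min (E n) (q n div 2)" for n
  have F: "F n < q n" for n using E_less[of n] by (simp add: F_def min_def)
  have "eventually (\<lambda>n. F n + 1 \<noteq> q n) sequentially"
    using large[of 2] by eventually_elim (simp add: F_def min_def, linarith)
  then have inf: "infinite {n. F n + 1 \<noteq> q n}"
    by (rule infinite_of_eventually)
  obtain x where "\<forall>B n. block_count q B x n = occurrences (\<lambda>n. int (F n)) B n"
    "\<forall>n. frac (qprod q n * x)
      \<in> {real (F (Suc n)) / real (q (Suc n))..(real (F (Suc n)) + 1) / real (q (Suc n))}"
    using real_with_digits[OF q_ge F inf] by blast
  note x = this[rule_format]
  have "(\<lambda>n. real (block_count q B x n) / Q_sum q (length B) n) \<longlonglongrightarrow> 1" for B
    unfolding x(1)
  proof (rule occurrences_limit_cong[OF _ Q_lim occ_lim])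
    fix d
    \<comment> \<open>For \<open>q n > 2 * d + 2\<close> the cap \<open>q n div 2\<close> exceeds
      \<open>d\<close>, so capping neither creates nor destroys the digit \<open>d\<close>.\<close>
    show "eventually (\<lambda>n. int (E n) = int d \<longleftrightarrow> int (F n) = int d) sequentially"
      using large[of "2 * d + 2"] by eventually_elim (auto simp: F_def min_def)
  qed
  then have "x \<in> normal_numbers q" by (auto simp: normal_numbers_def)
  moreover have "x \<notin> distribution_normal_numbers q"
  proof
    assume "x \<in> distribution_normal_numbers q"
    then have ud: "uniformly_distributed_mod_1 (\<lambda>n. qprod q n * x)"
      by (simp add: distribution_normal_numbers_def qprod_def)
    \<comment> \<open>Uniform distribution would send a quarter of the orbit to [3/4,1), but once
      \<open>q n > 4\<close> the bound \<open>q n div 2 + 1\<close> is less than three quarters of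
      \<open>q n\<close>.\<close>
    let ?A = "\<lambda>N. {n. n < N \<and> 3/4 \<le> frac (qprod q n * x) \<and> frac (qprod q n * x) < 1}"
    have quarter: "(\<lambda>N. real (card (?A N)) / real N) \<longlonglongrightarrow> 1 - 3/4"
      using ud[unfolded uniformly_distributed_mod_1_def, rule_format, of "3/4" 1] by simp
    obtain N0 where N0: "\<And>n. n \<ge> N0 \<Longrightarrow> q n > 4"
      using large[of 4] by (auto simp: eventually_sequentially)
    have small: "frac (qprod q n * x) < 3/4" if "n \<ge> N0" for n
    proof -
      have "4 * (F (Suc n) + 1) < 3 * q (Suc n)"
        using N0[of "Suc n"] that by (auto simp: F_def min_def)
      then have "real (4 * (F (Suc n) + 1)) < real (3 * q (Suc n))" by (simp only: of_nat_less_iff)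
      then have "(real (F (Suc n)) + 1) / real (q (Suc n)) < 3/4"
        using N0[of "Suc n"] that by (simp add: divide_less_eq)
      then show ?thesis using x(2)[of n] by (meson atLeastAtMost_iff le_less_trans)
    qed
    have zero: "(\<lambda>N. real (card (?A N)) / real N) \<longlonglongrightarrow> 0"
    proof (rule Lim_null_comparison)
      have "?A N \<subseteq> {..<N0}" for N using small by (auto simp: not_le[symmetric])
      then have "card (?A N) \<le> N0" for N using card_mono[of "{..<N0}" "?A N"] by simp
      then show "eventually (\<lambda>N. norm (real (card (?A N)) / real N) \<le> real N0 / real N) sequentially"
        by (intro always_eventually allI) (simp add: divide_right_mono)
    qed (rule lim_const_over_n)
    from LIMSEQ_unique[OF quarter zero] show False by simp
  qed
  ultimately show ?thesis using admissible_base[OF q_ge q_lim Q_lim] by blast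
qed

lemma (in normal_digits) distribution_normal_not_ratio_normal:
  "\<exists>q x. basic_sequence q \<and> infinite_in_limit q \<and> fully_divergent q \<and>
    x \<in> distribution_normal_numbers q \<and> x \<notin> ratio_normal_numbers q"
proof -
  \<comment> \<open>The lower bound removes the digit 0; the cap avoids the maximal digit once
    \<open>q n > 3\<close>, so the expansion is admissible. Either change moves a digit by at most
    1.\<close>
  define F where "F n = max 1 (min (E n) (q n - 2))" for n
  have F: "F n < q n" for n using E_less[of n] q_ge[of n] by (simp add: F_def)
  have "eventually (\<lambda>n. F n + 1 \<noteq> q n) sequentially"
    using large[of 3] by eventually_elim (auto simp: F_def)
  then have inf: "infinite {n. F n + 1 \<noteq> q n}"
    by (rule infinite_of_eventually)
  obtain x where "\<forall>B n. block_count q B x n = occurrences (\<lambda>n. int (F n)) B n"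
    "\<forall>n. frac (qprod q n * x)
      \<in> {real (F (Suc n)) / real (q (Suc n))..(real (F (Suc n)) + 1) / real (q (Suc n))}"
    using real_with_digits[OF q_ge F inf] by blast
  note x = this[rule_format]
  have "uniformly_distributed_mod_1 (\<lambda>n. real (F (Suc n)) / real (q (Suc n)))"
  proof (rule uniformly_distributed_mod_1_perturb[OF uniform])
    have fr: "frac (real (G (Suc n)) / real (q (Suc n))) = real (G (Suc n)) / real (q (Suc n))"
      if "\<And>n. G n < q n" for G n using that[of "Suc n"] by (simp add: frac_eq)
    show "(\<lambda>n. frac (real (F (Suc n)) / real (q (Suc n))) - frac (real (E (Suc n)) / real (q (Suc n)))) \<longlonglongrightarrow> 0"
      unfolding fr[of F, OF F] fr[of E, OF E_less]
    proof (rule Lim_null_comparison)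
      have "norm (real (F (Suc n)) / real (q (Suc n)) - real (E (Suc n)) / real (q (Suc n))) \<le> 1 / real (q (Suc n))" for n
      proof -
        have "\<bar>real (F (Suc n)) - real (E (Suc n))\<bar> \<le> 1" using E_less[of "Suc n"] q_ge[of "Suc n"] by (auto simp: F_def)
        then show ?thesis by (simp add: divide_right_mono abs_divide flip: diff_divide_distrib)
      qed
      then show "eventually (\<lambda>n. norm (real (F (Suc n)) / real (q (Suc n)) - real (E (Suc n)) / real (q (Suc n)))
          \<le> 1 / real (q (Suc n))) sequentially" by (intro always_eventually allI)
    qed (rule inverse_lim[OF q_lim])
  qed
  then have "x \<in> distribution_normal_numbers q"
    by (rule distribution_normal_of_digits[OF q_ge q_lim F _ x(2)])
  moreover have "x \<notin> ratio_normal_numbers q"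
  proof
    assume ratio: "x \<in> ratio_normal_numbers q"
    \<comment> \<open>The block \<open>[0]\<close> never occurs, so comparing it with itself gives
      0/0, whose default value 0 contradicts the limit 1.\<close>
    have "(\<lambda>n. real (block_count q [0] x n) / real (block_count q [0] x n)) \<longlonglongrightarrow> 1"
      by (rule ratio[unfolded ratio_normal_numbers_def mem_Collect_eq, rule_format, of 1 "[0]" "[0]"]) simp_all
    moreover have "block_count q [0] x n = 0" for n
    proof -
      have "F m \<noteq> 0" for m by (simp add: F_def)
      then show ?thesis unfolding x(1) by (simp add: occurrences_def)
    qed
    ultimately show False by (simp add: LIMSEQ_const_iff)
  qed
  ultimately show ?thesis using admissible_base[OF q_ge q_lim Q_lim] by blast
qed

lemma (in normal_digits) ratio_and_distribution_normal_not_normal: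
  "\<exists>q x. basic_sequence q \<and> infinite_in_limit q \<and> fully_divergent q \<and>
    x \<in> ratio_normal_numbers q \<and> x \<in> distribution_normal_numbers q \<and> x \<notin> normal_numbers q"
proof -
  define q' where "q' n = 2 * q n" for n
  define F where "F n = (if E n ^ 2 < q n then E n else 2 * E n)" for n
  have q': "2 \<le> q' n" for n using q_ge[of n] by (simp add: q'_def)
  have lim': "filterlim q' at_top sequentially"
    by (rule filterlim_at_top_mono[OF q_lim]) (simp add: q'_def)
  \<comment> \<open>A doubled digit plus 1 is odd and a kept digit is below \<open>q n\<close>, so
    the maximal digit \<open>q' n - 1\<close> never appears.\<close>
  have F: "F n < q' n" "F n + 1 \<noteq> q' n" for n
    using E_less[of n] by (auto simp: F_def q'_def)
  have Q': "Q_sum q' k n = 1 / 2 ^ k * Q_sum q k n" for k n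
    by (simp add: Q_sum_def q'_def prod.distrib sum_distrib_left)
  have div': "filterlim (Q_sum q' k) at_top sequentially" for k
    unfolding Q'[abs_def] by (intro filterlim_tendsto_pos_mult_at_top[OF tendsto_const _ Q_lim]) simp
  have "{n. F n + 1 \<noteq> q' n} = UNIV" using F(2) by blast
  then have inf: "infinite {n. F n + 1 \<noteq> q' n}" by simp
  obtain x where "\<forall>B n. block_count q' B x n = occurrences (\<lambda>n. int (F n)) B n"
    "\<forall>n. frac (qprod q' n * x)
      \<in> {real (F (Suc n)) / real (q' (Suc n))..(real (F (Suc n)) + 1) / real (q' (Suc n))}"
    using real_with_digits[OF q' F(1) inf] by blast
  note x = this[rule_format]
  \<comment> \<open>The counts still follow the sum for \<open>q\<close>, whereas normality for
    \<open>q'\<close> would require the smaller sum for \<open>q'\<close>.\<close>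
  have count: "(\<lambda>n. real (block_count q' B x n) / Q_sum q (length B) n) \<longlonglongrightarrow> 1" for B
    unfolding x(1)
  proof (rule occurrences_limit_cong[OF _ Q_lim occ_lim])
    fix d
    show "eventually (\<lambda>n. int (E n) = int d \<longleftrightarrow> int (F n) = int d) sequentially"
      using large[of "d ^ 2"]
    proof eventually_elim
      case (elim n)
      \<comment> \<open>If doubling produced \<open>d\<close>, then
        \<open>E n ^ 2 \<le> d ^ 2 < q n\<close>, so the digit would have been kept instead.\<close>
      have "E n ^ 2 \<le> d ^ 2" if "2 * E n = d" using that by (intro power_mono) auto
      then show ?case using elim by (auto simp: F_def)
    qed
  qed
  have "x \<in> ratio_normal_numbers q'"
    unfolding ratio_normal_numbers_def
  proof (intro CollectI allI impI)
    fix k :: nat and B1 B2 :: "nat list"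
    assume "length B1 = k \<and> length B2 = k"
    then show "(\<lambda>n. real (block_count q' B1 x n) / real (block_count q' B2 x n)) \<longlonglongrightarrow> 1"
      using count[of B1] count[of B2] by (auto intro: quotient_limit[OF Q_lim[of k]])
  qed
  moreover have "uniformly_distributed_mod_1 (\<lambda>n. real (F (Suc n)) / real (q' (Suc n)))"
  proof (rule uniformly_distributed_mod_1_perturb[OF uniform])
    have fr: "frac (real (F (Suc n)) / real (q' (Suc n))) = real (F (Suc n)) / real (q' (Suc n))"
      "frac (real (E (Suc n)) / real (q (Suc n))) = real (E (Suc n)) / real (q (Suc n))" for n
      using F(1)[of "Suc n"] E_less[of "Suc n"] by (simp_all add: frac_eq)
    show "(\<lambda>n. frac (real (F (Suc n)) / real (q' (Suc n))) - frac (real (E (Suc n)) / real (q (Suc n)))) \<longlonglongrightarrow> 0"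
      unfolding fr
    proof (rule Lim_null_comparison)
      \<comment> \<open>Doubling preserves the quotient exactly. A kept digit is below the square
        root of \<open>q m\<close>, so its quotient is at most \<open>sqrt (1 / q m)\<close> and is
        merely halved.\<close>
      have "norm (real (F m) / real (q' m) - real (E m) / real (q m)) \<le> sqrt (1 / real (q m))" for m
      proof (cases "E m ^ 2 < q m")
        case True
        have qm: "real (q m) > 0" using q_ge[of m] by simp
        have "real (E m ^ 2) \<le> real (q m)" using True by (intro of_nat_mono) simp
        then have "(real (E m) / real (q m)) ^ 2 \<le> real (q m) / real (q m) ^ 2"
          unfolding power_divide by (intro divide_right_mono) auto
        then have "(real (E m) / real (q m)) ^ 2 \<le> 1 / real (q m)"
          using qm by (simp add: power2_eq_square)
        then have le: "real (E m) / real (q m) \<le> sqrt (1 / real (q m))" by (rule real_le_rsqrt)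
        have half: "real (F m) / real (q' m) - real (E m) / real (q m) = - (real (E m) / real (q m) / 2)"
          using True qm by (simp add: F_def q'_def field_simps)
        have abs_half: "\<bar>- (y / 2)\<bar> \<le> z" if "0 \<le> y" "y \<le> z" for y z :: real using that by linarith
        show ?thesis unfolding half real_norm_def by (rule abs_half[OF _ le]) simp
      qed (simp add: F_def q'_def)
      then show "eventually (\<lambda>n. norm (real (F (Suc n)) / real (q' (Suc n)) - real (E (Suc n)) / real (q (Suc n)))
          \<le> sqrt (1 / real (q (Suc n)))) sequentially" by (intro always_eventually allI)
      show "(\<lambda>n. sqrt (1 / real (q (Suc n)))) \<longlonglongrightarrow> 0"
        using tendsto_real_sqrt[OF inverse_lim[OF q_lim, of 1]] by simp
    qed
  qed
  then have "x \<in> distribution_normal_numbers q'"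
    by (rule distribution_normal_of_digits[OF q' lim' F(1) _ x(2)])
  moreover have "x \<notin> normal_numbers q'"
  proof
    assume "x \<in> normal_numbers q'"
    then have one: "(\<lambda>n. real (block_count q' [0] x n) / Q_sum q' 1 n) \<longlonglongrightarrow> 1"
      by (simp add: normal_numbers_def)
    have "(\<lambda>n. 2 * (real (block_count q' [0] x n) / Q_sum q 1 n)) \<longlonglongrightarrow> 2 * 1"
      using count[of "[0]"] by (intro tendsto_mult tendsto_const) simp
    then have two: "(\<lambda>n. real (block_count q' [0] x n) / Q_sum q' 1 n) \<longlonglongrightarrow> 2"
      by (simp add: Q' mult.commute)
    from LIMSEQ_unique[OF one two] show False by simp
  qed
  ultimately show ?thesis using admissible_base[OF q' lim' div'] by blast
qed

theorem theorem1p2: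
  fixes A B :: label
  shows "(\<forall>q. basic_sequence q \<and> infinite_in_limit q \<and> fully_divergent q
              \<longrightarrow> label_set A q \<subseteq> label_set B q)
         \<longleftrightarrow> (A, B) \<in> G_edges\<^sup>*"
proof
  assume sub: "\<forall>q. basic_sequence q \<and> infinite_in_limit q \<and> fully_divergent q
              \<longrightarrow> label_set A q \<subseteq> label_set B q"
  obtain q E where "normal_digits q E" using normal_digits_exist by blast
  then interpret digits: normal_digits q E .
  \<comment> \<open>The witnesses rule out missing paths: \<open>x1\<close> those from labels
    without DN to labels with DN, \<open>x2\<close> those from RN, DN and their intersection to
    labels with N, and \<open>x3\<close> those from DN to labels with RN.\<close>
  obtain q1 x1 where 1: "x1 \<in> normal_numbers q1" "x1 \<in> ratio_normal_numbers q1"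
      "x1 \<notin> distribution_normal_numbers q1" "label_set A q1 \<subseteq> label_set B q1"
    using digits.normal_not_distribution_normal normal_subset_ratio_normal sub by blast
  obtain q2 x2 where 2: "x2 \<in> ratio_normal_numbers q2" "x2 \<in> distribution_normal_numbers q2"
      "x2 \<notin> normal_numbers q2" "label_set A q2 \<subseteq> label_set B q2"
    using digits.ratio_and_distribution_normal_not_normal sub by blast
  obtain q3 x3 where 3: "x3 \<in> distribution_normal_numbers q3" "x3 \<notin> ratio_normal_numbers q3"
      "label_set A q3 \<subseteq> label_set B q3"
    using digits.distribution_normal_not_ratio_normal sub by blast
  have edge: "(a, b) \<in> G_edges\<^sup>*" if "(a, b) \<in> G_edges" for a b
    using that by blast
  have paths: "(L_RN_DN, L_RN) \<in> G_edges\<^sup>*" "(L_RN_DN, L_DN) \<in> G_edges\<^sup>*"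
    "(L_N, L_RN) \<in> G_edges\<^sup>*" "(L_N, L_N_RN) \<in> G_edges\<^sup>*" "(L_N_RN, L_N) \<in> G_edges\<^sup>*"
    "(L_N_DN, L_RN_DN) \<in> G_edges\<^sup>*" "(L_N_DN, L_N) \<in> G_edges\<^sup>*"
    "(L_N_DN, L_N_RN_DN) \<in> G_edges\<^sup>*" "(L_N_RN_DN, L_N_DN) \<in> G_edges\<^sup>*"
    by (intro edge; simp add: G_edges_def)+
  \<comment> \<open>Composing edges in two rounds lists every reachable pair of distinct labels, so
    the final case split needs no search in the closure.\<close>
  note paths = paths paths(5)[THEN rtrancl_trans, OF paths(3)]
    paths(6)[THEN rtrancl_trans, OF paths(1)] paths(6)[THEN rtrancl_trans, OF paths(2)]
    paths(7)[THEN rtrancl_trans, OF paths(4)]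
  note paths = paths paths(9)[THEN rtrancl_trans, OF paths(6)] paths(9)[THEN rtrancl_trans, OF paths(7)]
    paths(9)[THEN rtrancl_trans, OF paths(11)] paths(9)[THEN rtrancl_trans, OF paths(12)]
    paths(9)[THEN rtrancl_trans, OF paths(13)]
  have "x1 \<in> label_set A q1 \<longrightarrow> x1 \<in> label_set B q1"
    "x2 \<in> label_set A q2 \<longrightarrow> x2 \<in> label_set B q2"
    "x3 \<in> label_set A q3 \<longrightarrow> x3 \<in> label_set B q3"
    using 1(4) 2(4) 3(3) by blast+
  then show "(A, B) \<in> G_edges\<^sup>*"
    using 1(1-3) 2(1-3) 3(1,2) paths by (cases A; cases B; simp)
next
  assume "(A, B) \<in> G_edges\<^sup>*"
  then show "\<forall>q. basic_sequence q \<and> infinite_in_limit q \<and> fully_divergent q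
              \<longrightarrow> label_set A q \<subseteq> label_set B q"
    using containment_of_path by blast
qed

end
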